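(* (SUCI4.) Let $s=4$, $\gamma_0=0$, $\gamma_4=1$, let $\gamma_1>0$ and $\gamma_2,\gamma_3$ be real, set $\alpha_{10}=\alpha_{11}=\alpha_{22}=\alpha_{33}=\alpha_{44}=\gamma_1/2$, and define $$\alpha_{43}=\frac{6(1-\gamma_2)\gamma_1^2+12\gamma_1\gamma_2-10\gamma_1-4\gamma_2+3}{12\gamma_3(\gamma_3-\gamma_2)(\gamma_3-\gamma_1)},\qquad \alpha_{42}=\frac{6\alpha_{43}\gamma_1\gamma_3-6\alpha_{43}\gamma_3^2+3\gamma_1^2-6\gamma_1+2}{6\gamma_2(\gamma_2-\gamma_1)},$$ $$\alpha_{32}=\frac{-3\gamma_1^3+9\gamma_1^2-6\gamma_1+1}{12\alpha_{43}\gamma_2(\gamma_2-\gamma_1)},\qquad \alpha_{20}=\frac{-\gamma_1^2+3\gamma_1\gamma_2-\gamma_2^2}{2\gamma_1},\qquad \alpha_{21}=\frac{\gamma_2(\gamma_2-\gamma_1)}{2\gamma_1},$$ $$\alpha_{30}=\frac{-\gamma_1^2+(3\gamma_3-2\alpha_{32})\gamma_1+2\alpha_{32}\gamma_2-\gamma_3^2}{2\gamma_1},\qquad \alpha_{31}=\frac{-2\alpha_{32}\gamma_2-\gamma_1\gamma_3+\gamma_3^2}{2\gamma_1},$$ $$\alpha_{40}=\frac{-\gamma_1^2+(3-2\alpha_{42}-2\alpha_{43})\gamma_1+2\alpha_{42}\gamma_2+2\alpha_{43}\gamma_3-1}{2\gamma_1},\qquad \alpha_{41}=\frac{-2\alpha_{42}\gamma_2-2\alpha_{43}\gamma_3-\gamma_1+1}{2\gamma_1},$$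 where $\gamma_1,\gamma_2,\gamma_3$ are assumed to be such that all denominators are nonzero. Let $$R_\infty(\gamma_1)=\frac{3\gamma_1^4-24\gamma_1^3+36\gamma_1^2-16\gamma_1+2}{3\gamma_1^4}.$$ Then there are real numbers $a<b$, independent of the parameters, with $|a-0.7886751346|\le10^{-8}$ and $|b-2.561159523|\le10^{-8}$, such that the four-sub-step method with these parameters satisfies: (a) it is fourth-order accurate; (b) it is unconditionally stable if and only if $\gamma_1\in[a,b]$; (c) as $\omega\to\infty$ with $\Delta t>0$ and $\xi\in[0,1)$ fixed, the characteristic polynomial of $\mathbf D_{num}$ tends to $(\zeta-R_\infty(\gamma_1))^2$; and for every $\rho_\infty\in[0,1]$ precisely one solution $\gamma_1$ of $R_\infty(\gamma_1)=\rho_\infty$ lies in $[a,b]$.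
   Context: The $s$-sub-step method. For the scalar equation $\ddot u(t)+2\xi\omega\dot u(t)+\omega^2u(t)=f(t)$ with $\omega>0$, $\xi\in[0,1)$, and a step from $t_n$ to $t_{n+1}=t_n+\Delta t$ starting from $(u_n,\dot u_n)$ with $\ddot u_n=f(t_n)-2\xi\omega\dot u_n-\omega^2u_n$, the $s$-sub-step method computes, for $i=1,\dots,s$, $$\ddot u_{n+\gamma_i}+2\xi\omega\dot u_{n+\gamma_i}+\omega^2u_{n+\gamma_i}=f(t_n+\gamma_i\Delta t),\quad u_{n+\gamma_i}=u_n+\Delta t\sum_{j=0}^{i}\alpha_{ij}\dot u_{n+\gamma_j},\quad \dot u_{n+\gamma_i}=\dot u_n+\Delta t\sum_{j=0}^{i}\alpha_{ij}\ddot u_{n+\gamma_j},$$ where $\gamma_0=0$, $\gamma_s=1$, and $u_{n+\gamma_0}=u_n$ (similarly for derivatives). The numerical solution at $t_{n+1}$ is $(u_{n+1},\dot u_{n+1})=(u_{n+\gamma_s},\dot u_{n+\gamma_s})$. It has the form $(u_{n+1},\dot u_{n+1})^{\mathsf T}=\mathbf D_{num}(u_n,\dot u_n)^{\mathsf T}+\mathbf L_{num}$, where the $2\times2$ amplification matrix $\mathbf D_{num}$ depends on $\xi,\omega,\Delta t$ and the parameters, and $\mathbf L_{num}$ depends also on $f$. Exact solution operators. Take $t_n=0$ and $f(t)=\exp(t)$. The exact solution with data $(u_n,\dot u_n)$ at $t_n$ satisfies $(u(t_{n+1}),\dot u(t_{n+1}))^{\mathsf T}=\mathbf D_{exa}(u_n,\dot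 u_n)^{\mathsf T}+\mathbf L_{exa}$, where $\mathbf D_{exa}$ is the exact $2\times 2$ propagator of the homogeneous equation over time $\Delta t$ and $\mathbf L_{exa}$ is the value at time $\Delta t$ of (displacement, velocity) for the solution with load $\exp(t)$ and zero data at $t=0$. $p$th-order accuracy: for all $\omega>0$, $\xi\in[0,1)$, with load $f(t)=\exp(t)$ and $t_n=0$, one has $\mathbf D_{num}-\mathbf D_{exa}=O(\Delta t^{p+1})$ and $\mathbf L_{num}-\mathbf L_{exa}=O(\Delta t^{p+1})$ entrywise as $\Delta t\to0$. Unconditional stability: for $\xi=0$ the spectral radius of $\mathbf D_{num}$ is at most $1$ for all $\Omega=\omega\Delta t\in[0,\infty)$. *)

theory Defs
  imports "HOL-Library.Landau_Symbols" "Jordan_Normal_Form.Spectral_Radius"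
begin

text \<open>States are vectors (displacement, velocity). The relation below says that y is the result of
  one step of the s-sub-step method of size \<open>dt\<close> from \<open>tn\<close> and x; the families u, v, a are the
  displacements, velocities and accelerations at the sub-steps \<open>tn + \<gamma> i * dt\<close>. The coefficients
  \<open>\<alpha> i j\<close> matter only for \<open>1 \<le> i \<le> s\<close> and \<open>j \<le> i\<close>.\<close>

definition substep_step ::
  "nat \<Rightarrow> (nat \<Rightarrow> nat \<Rightarrow> real) \<Rightarrow> (nat \<Rightarrow> real) \<Rightarrow> real \<Rightarrow> real \<Rightarrow> (real \<Rightarrow> real) \<Rightarrow> real \<Rightarrow> real
     \<Rightarrow> real vec \<Rightarrow> real vec \<Rightarrow> bool"
where
  "substep_step s \<alpha> \<gamma> \<xi> \<omega> f tn dt x y \<longleftrightarrow>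
     (\<exists>u v a :: nat \<Rightarrow> real.
        x = vec_of_list [u 0, v 0] \<and>
        a 0 = f tn - 2 * \<xi> * \<omega> * v 0 - \<omega>\<^sup>2 * u 0 \<and>
        (\<forall>i\<in>{1..s}.
           a i + 2 * \<xi> * \<omega> * v i + \<omega>\<^sup>2 * u i = f (tn + \<gamma> i * dt) \<and>
           u i = u 0 + dt * (\<Sum>j=0..i. \<alpha> i j * v j) \<and>
           v i = v 0 + dt * (\<Sum>j=0..i. \<alpha> i j * a j)) \<and>
        y = vec_of_list [u s, v s])"

definition D_num ::
  "nat \<Rightarrow> (nat \<Rightarrow> nat \<Rightarrow> real) \<Rightarrow> (nat \<Rightarrow> real) \<Rightarrow> real \<Rightarrow> real \<Rightarrow> real \<Rightarrow> real mat"
where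
  "D_num s \<alpha> \<gamma> \<xi> \<omega> dt =
     (THE D. D \<in> carrier_mat 2 2 \<and>
        (\<forall>f tn. \<exists>L\<in>carrier_vec 2. \<forall>x\<in>carrier_vec 2. \<forall>y\<in>carrier_vec 2.
           substep_step s \<alpha> \<gamma> \<xi> \<omega> f tn dt x y \<longleftrightarrow> y = D *\<^sub>v x + L))"

definition L_num ::
  "nat \<Rightarrow> (nat \<Rightarrow> nat \<Rightarrow> real) \<Rightarrow> (nat \<Rightarrow> real) \<Rightarrow> real \<Rightarrow> real \<Rightarrow> (real \<Rightarrow> real) \<Rightarrow> real \<Rightarrow> real
     \<Rightarrow> real vec"
where
  "L_num s \<alpha> \<gamma> \<xi> \<omega> f tn dt =
     (THE L. L \<in> carrier_vec 2 \<and>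
        (\<forall>x\<in>carrier_vec 2. \<forall>y\<in>carrier_vec 2.
           substep_step s \<alpha> \<gamma> \<xi> \<omega> f tn dt x y \<longleftrightarrow> y = D_num s \<alpha> \<gamma> \<xi> \<omega> dt *\<^sub>v x + L))"

definition exact_step ::
  "real \<Rightarrow> real \<Rightarrow> (real \<Rightarrow> real) \<Rightarrow> real \<Rightarrow> real \<Rightarrow> real vec \<Rightarrow> real vec \<Rightarrow> bool"
where
  "exact_step \<xi> \<omega> f tn dt x y \<longleftrightarrow>
     (\<exists>u v :: real \<Rightarrow> real.
        x = vec_of_list [u tn, v tn] \<and>
        (\<forall>t\<in>{tn..tn + dt}.
           (u has_real_derivative v t) (at t within {tn..tn + dt}) \<and>
           (v has_real_derivative f t - 2 * \<xi> * \<omega> * v t - \<omega>\<^sup>2 * u t) (at t within {tn..tn + dt})) \<and>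
        y = vec_of_list [u (tn + dt), v (tn + dt)])"

definition D_exa :: "real \<Rightarrow> real \<Rightarrow> real \<Rightarrow> real mat" where
  "D_exa \<xi> \<omega> dt =
     (THE D. D \<in> carrier_mat 2 2 \<and>
        (\<forall>x\<in>carrier_vec 2. \<forall>y\<in>carrier_vec 2.
           exact_step \<xi> \<omega> (\<lambda>t. 0) 0 dt x y \<longleftrightarrow> y = D *\<^sub>v x))"

definition L_exa :: "real \<Rightarrow> real \<Rightarrow> real \<Rightarrow> real vec" where
  "L_exa \<xi> \<omega> dt = (THE L. exact_step \<xi> \<omega> exp 0 dt (0\<^sub>v 2) L)"

definition accurate_of_order ::
  "nat \<Rightarrow> nat \<Rightarrow> (nat \<Rightarrow> nat \<Rightarrow> real) \<Rightarrow> (nat \<Rightarrow> real) \<Rightarrow> bool"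
where
  "accurate_of_order p s \<alpha> \<gamma> \<longleftrightarrow>
     (\<forall>\<omega>>0. \<forall>\<xi>\<in>{0..<1}. \<forall>i<2.
        (\<forall>j<2. (\<lambda>dt. D_num s \<alpha> \<gamma> \<xi> \<omega> dt $$ (i, j) - D_exa \<xi> \<omega> dt $$ (i, j))
                  \<in> O[at_right 0](\<lambda>dt. dt ^ (p + 1))) \<and>
        (\<lambda>dt. L_num s \<alpha> \<gamma> \<xi> \<omega> exp 0 dt $ i - L_exa \<xi> \<omega> dt $ i)
           \<in> O[at_right 0](\<lambda>dt. dt ^ (p + 1)))"

definition unconditionally_stable ::
  "nat \<Rightarrow> (nat \<Rightarrow> nat \<Rightarrow> real) \<Rightarrow> (nat \<Rightarrow> real) \<Rightarrow> bool"
where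
  "unconditionally_stable s \<alpha> \<gamma> \<longleftrightarrow>
     (\<forall>\<omega>>0. \<forall>dt\<ge>0. spectral_radius (map_mat complex_of_real (D_num s \<alpha> \<gamma> 0 \<omega> dt)) \<le> 1)"

definition suci4_params :: "(nat \<Rightarrow> nat \<Rightarrow> real) \<Rightarrow> (nat \<Rightarrow> real) \<Rightarrow> bool" where
  "suci4_params \<alpha> \<gamma> \<longleftrightarrow>
     \<gamma> 0 = 0 \<and> \<gamma> 4 = 1 \<and> \<gamma> 1 > 0 \<and>
     \<alpha> 1 0 = \<gamma> 1 / 2 \<and> \<alpha> 1 1 = \<gamma> 1 / 2 \<and> \<alpha> 2 2 = \<gamma> 1 / 2 \<and> \<alpha> 3 3 = \<gamma> 1 / 2 \<and> \<alpha> 4 4 = \<gamma> 1 / 2 \<and>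
     12 * \<gamma> 3 * (\<gamma> 3 - \<gamma> 2) * (\<gamma> 3 - \<gamma> 1) \<noteq> 0 \<and>
     6 * \<gamma> 2 * (\<gamma> 2 - \<gamma> 1) \<noteq> 0 \<and>
     12 * \<alpha> 4 3 * \<gamma> 2 * (\<gamma> 2 - \<gamma> 1) \<noteq> 0 \<and>
     \<alpha> 4 3 = (6 * (1 - \<gamma> 2) * (\<gamma> 1)\<^sup>2 + 12 * \<gamma> 1 * \<gamma> 2 - 10 * \<gamma> 1 - 4 * \<gamma> 2 + 3)
              / (12 * \<gamma> 3 * (\<gamma> 3 - \<gamma> 2) * (\<gamma> 3 - \<gamma> 1)) \<and>
     \<alpha> 4 2 = (6 * \<alpha> 4 3 * \<gamma> 1 * \<gamma> 3 - 6 * \<alpha> 4 3 * (\<gamma> 3)\<^sup>2 + 3 * (\<gamma> 1)\<^sup>2 - 6 * \<gamma> 1 + 2)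
              / (6 * \<gamma> 2 * (\<gamma> 2 - \<gamma> 1)) \<and>
     \<alpha> 3 2 = (- 3 * \<gamma> 1 ^ 3 + 9 * (\<gamma> 1)\<^sup>2 - 6 * \<gamma> 1 + 1)
              / (12 * \<alpha> 4 3 * \<gamma> 2 * (\<gamma> 2 - \<gamma> 1)) \<and>
     \<alpha> 2 0 = (- (\<gamma> 1)\<^sup>2 + 3 * \<gamma> 1 * \<gamma> 2 - (\<gamma> 2)\<^sup>2) / (2 * \<gamma> 1) \<and>
     \<alpha> 2 1 = \<gamma> 2 * (\<gamma> 2 - \<gamma> 1) / (2 * \<gamma> 1) \<and>
     \<alpha> 3 0 = (- (\<gamma> 1)\<^sup>2 + (3 * \<gamma> 3 - 2 * \<alpha> 3 2) * \<gamma> 1 + 2 * \<alpha> 3 2 * \<gamma> 2 - (\<gamma> 3)\<^sup>2) / (2 * \<gamma> 1) \<and>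
     \<alpha> 3 1 = (- 2 * \<alpha> 3 2 * \<gamma> 2 - \<gamma> 1 * \<gamma> 3 + (\<gamma> 3)\<^sup>2) / (2 * \<gamma> 1) \<and>
     \<alpha> 4 0 = (- (\<gamma> 1)\<^sup>2 + (3 - 2 * \<alpha> 4 2 - 2 * \<alpha> 4 3) * \<gamma> 1 + 2 * \<alpha> 4 2 * \<gamma> 2
                + 2 * \<alpha> 4 3 * \<gamma> 3 - 1) / (2 * \<gamma> 1) \<and>
     \<alpha> 4 1 = (- 2 * \<alpha> 4 2 * \<gamma> 2 - 2 * \<alpha> 4 3 * \<gamma> 3 - \<gamma> 1 + 1) / (2 * \<gamma> 1)"

definition R_infinity :: "real \<Rightarrow> real" where
  "R_infinity g = (3 * g ^ 4 - 24 * g ^ 3 + 36 * g\<^sup>2 - 16 * g + 2) / (3 * g ^ 4)"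

end

theory Submission
  imports "HOL-Analysis.Complex_Transcendental" Defs
begin

(* Both the parent theories use a dollar sign for vector components; keep only the one for real vec. *)
unbundle no vec_syntax

text \<open>
  Everything happens in one complex coordinate. Let \<open>\<mu>\<close> be the root of
  \<open>X\<^sup>2 + 2 \<xi> \<omega> X + \<omega>\<^sup>2\<close> in the upper half plane. For a solution with displacement \<open>u\<close> and velocity \<open>v\<close>
  the coordinate \<open>w = v - cnj \<mu> * u\<close> satisfies the scalar equation \<open>w' = \<mu> w + f\<close>, and since
  \<open>Im \<mu> > 0\<close> the map from \<open>(u, v)\<close> to \<open>w\<close> is a real linear bijection onto the complex numbers. The
  sub-step method commutes with this change of coordinates: it becomes the diagonally implicit
  Runge-Kutta method with coefficients \<open>\<alpha>\<close> for the scalar equation. Hence the numerical and the exact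
  propagators are multiplications by the complex numbers \<open>R(\<mu> dt)\<close> and \<open>exp (\<mu> dt)\<close> (\<open>num_eq\<close>, \<open>exa_eq\<close>),
  and a real matrix that is multiplication by \<open>r\<close> has the eigenvalues \<open>r\<close> and \<open>cnj r\<close>.

  Accuracy: the parameters make the method of stage order two (every sub-step integrates linear
  functions exactly), the last sub-step integrates cubics exactly, and the
  third order defects of the inner stages cancel in the last row. For a linear equation these
  conditions suffice for a one-step error of order \<open>dt\<^sup>5\<close> (\<open>step_error_bigo\<close>).

  Stability: with \<open>c = \<gamma> 1 / 2\<close>, the same conditions determine \<open>R\<close>, namely
  \<open>R(z) = P(z) / (1 - c z)\<^sup>4\<close> where \<open>P\<close> is the Taylor polynomial of degree four of \<open>exp z (1 - c z)\<^sup>4\<close>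
  (\<open>suci4_stability_function\<close>). Agreement with \<open>exp\<close> to fourth order wipes out the low powers of \<open>y\<close> in
  the difference of \<open>\<bar>1 - i c y\<bar>\<^sup>8\<close> and \<open>\<bar>P (i y)\<bar>\<^sup>2\<close>: what remains is \<open>y\<^sup>6\<close> times a linear
  polynomial in \<open>y\<^sup>2\<close> (\<open>stability_gap\<close>). So stability is equivalent to two polynomial inequalities in
  \<open>\<gamma> 1\<close>. The coefficient of \<open>y\<^sup>8\<close> factors and changes sign at \<open>a = (3 + sqrt 3) / 6\<close>, where \<open>R_infinity = 1\<close>;
  the coefficient of \<open>y\<^sup>6\<close> is a quintic whose largest root is \<open>b\<close> (\<open>stability_interval\<close>).

  Behaviour at infinity: \<open>R(z)\<close> tends to the quotient of the leading coefficients, which is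
  \<open>R_infinity (\<gamma> 1)\<close>. On the stability interval \<open>R_infinity\<close> falls strictly from \<open>1\<close> to negative values and
  then stays negative, so each value in \<open>[0, 1]\<close> is taken once (\<open>R_infinity_ex1\<close>).
\<close>

section \<open>The complex modal coordinate\<close>

lemma det_mat2:
  fixes A :: "'a :: comm_ring_1 mat"
  assumes A: "A \<in> carrier_mat 2 2"
  shows "det A = A $$ (0,0) * A $$ (1,1) - A $$ (0,1) * A $$ (1,0)"
proof -
  have "det A = (\<Sum>i<2. A $$ (i,0) * cofactor A i 0)"
    by (rule laplace_expansion_column[OF A]) simp
  also have "\<dots> = A $$ (0,0) * det (mat_delete A 0 0) - A $$ (1,0) * det (mat_delete A 1 0)"
    by (simp add: numeral_2_eq_2 cofactor_def)
  also have "det (mat_delete A 0 0) = A $$ (1,1)"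
    using A by (subst det_single) (auto simp: mat_delete_def)
  also have "det (mat_delete A 1 0) = A $$ (0,1)"
    using A by (subst det_single) (auto simp: mat_delete_def)
  finally show ?thesis by (simp add: algebra_simps)
qed

lemma char_poly_mat2:
  fixes A :: "'a :: comm_ring_1 mat"
  assumes A: "A \<in> carrier_mat 2 2"
  shows "char_poly A =
    [:A $$ (0,0) * A $$ (1,1) - A $$ (0,1) * A $$ (1,0), - (A $$ (0,0) + A $$ (1,1)), 1:]"
  unfolding char_poly_def using A
  by (subst det_mat2) (auto simp: char_poly_matrix_def algebra_simps)

text \<open>The root of the characteristic equation with positive imaginary part; it is not real because of \<open>\<xi> < 1\<close>.\<close>
definition eig :: "real \<Rightarrow> real \<Rightarrow> complex" where
  "eig \<xi> \<omega> = Complex (- \<xi> * \<omega>) (\<omega> * sqrt (1 - \<xi>\<^sup>2))"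

lemma eig_props:
  assumes "\<omega> > 0" "\<xi> \<in> {0..<1}"
  shows "Im (eig \<xi> \<omega>) > 0" "2 * Re (eig \<xi> \<omega>) = - 2 * \<xi> * \<omega>" "(norm (eig \<xi> \<omega>))\<^sup>2 = \<omega>\<^sup>2"
proof -
  have x: "\<xi>\<^sup>2 < 1" using assms by (simp add: power_less_one_iff abs_square_less_1)
  then show "Im (eig \<xi> \<omega>) > 0" using assms by (simp add: eig_def)
  show "2 * Re (eig \<xi> \<omega>) = - 2 * \<xi> * \<omega>" by (simp add: eig_def)
  show "(norm (eig \<xi> \<omega>))\<^sup>2 = \<omega>\<^sup>2" using x
    by (simp add: eig_def cmod_power2 power_mult_distrib algebra_simps)
qed

text \<open>The left eigenvector \<open>(- cnj \<mu>, 1)\<close> of the companion matrix, applied to (displacement, velocity).\<close>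
definition modal :: "complex \<Rightarrow> real vec \<Rightarrow> complex" where
  "modal \<mu> x = of_real (x $ 1) - cnj \<mu> * of_real (x $ 0)"

definition unmodal :: "complex \<Rightarrow> complex \<Rightarrow> real vec" where
  "unmodal \<mu> w = vec_of_list [Im w / Im \<mu>, Re w + Re \<mu> * (Im w / Im \<mu>)]"

text \<open>The real matrix of multiplication by \<open>r\<close> in the modal coordinate. It is \<open>p I + q M\<close> for the companion
  matrix \<open>M\<close> of the oscillator, with the real \<open>p\<close> and \<open>q\<close> for which \<open>p + q \<mu> = r\<close>.\<close>
definition modal_mat :: "complex \<Rightarrow> complex \<Rightarrow> real mat" where
  "modal_mat \<mu> r = (let q = Im r / Im \<mu> in Matrix.mat 2 2
     (\<lambda>(i, j). [[Re r - Re \<mu> * q, q], [- (norm \<mu>)\<^sup>2 * q, Re r + Re \<mu> * q]] ! i ! j))"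

lemma unmodal_carrier [simp]: "unmodal \<mu> w \<in> carrier_vec 2"
  unfolding unmodal_def by (rule carrier_vecI) simp

lemma unmodal_dim [simp]: "dim_vec (unmodal \<mu> w) = 2"
  by (simp add: unmodal_def)

lemma unmodal_index [simp]:
  "unmodal \<mu> w $ 0 = Im w / Im \<mu>" "unmodal \<mu> w $ 1 = Re w + Re \<mu> * (Im w / Im \<mu>)"
  "unmodal \<mu> w $ Suc 0 = Re w + Re \<mu> * (Im w / Im \<mu>)"
  by (simp_all add: unmodal_def)

lemma modal_mat_carrier [simp]: "modal_mat \<mu> r \<in> carrier_mat 2 2"
  by (simp add: modal_mat_def Let_def)

lemma modal_mat_index [simp]:
  "modal_mat \<mu> r $$ (0, 0) = Re r - Re \<mu> * (Im r / Im \<mu>)"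
  "modal_mat \<mu> r $$ (0, Suc 0) = Im r / Im \<mu>"
  "modal_mat \<mu> r $$ (Suc 0, 0) = - (norm \<mu>)\<^sup>2 * (Im r / Im \<mu>)"
  "modal_mat \<mu> r $$ (Suc 0, Suc 0) = Re r + Re \<mu> * (Im r / Im \<mu>)"
  by (simp_all add: modal_mat_def Let_def)

lemma modal_unmodal: "Im \<mu> \<noteq> 0 \<Longrightarrow> modal \<mu> (unmodal \<mu> w) = w"
  by (simp add: modal_def complex_eq_iff)

lemma vec2_eq_iff:
  assumes "x \<in> carrier_vec 2" "y \<in> carrier_vec 2"
  shows "x = y \<longleftrightarrow> x $ 0 = y $ 0 \<and> x $ 1 = y $ 1"
  using assms by (auto simp: vec_eq_iff less_2_cases_iff)

lemma modal_eq_iff: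
  assumes "Im \<mu> \<noteq> 0" "x \<in> carrier_vec 2" "y \<in> carrier_vec 2"
  shows "modal \<mu> x = modal \<mu> y \<longleftrightarrow> x = y"
  using assms by (auto simp: vec2_eq_iff modal_def complex_eq_iff)

lemma modal_linear:
  assumes "x \<in> carrier_vec 2" "y \<in> carrier_vec 2"
  shows "modal \<mu> (x + y) = modal \<mu> x + modal \<mu> y"
  using assms by (simp add: modal_def algebra_simps)

lemma modal_mat_mult:
  assumes "Im \<mu> \<noteq> 0" "x \<in> carrier_vec 2"
  shows "modal \<mu> (modal_mat \<mu> r *\<^sub>v x) = r * modal \<mu> x"
proof -
  have d: "dim_row (modal_mat \<mu> r) = 2" "dim_col (modal_mat \<mu> r) = 2"
    using modal_mat_carrier[of \<mu> r] by (auto simp del: modal_mat_carrier)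
  have dx: "dim_vec x = 2" using assms(2) by auto
  have i: "(modal_mat \<mu> r *\<^sub>v x) $ i = modal_mat \<mu> r $$ (i,0) * x $ 0 + modal_mat \<mu> r $$ (i,1) * x $ 1"
    if "i < 2" for i
    using that d dx by (simp add: mult_mat_vec_def scalar_prod_def row_def numeral_2_eq_2)
  define q where "q = Im r / Im \<mu>"
  have r: "Im r = q * Im \<mu>" using assms(1) by (simp add: q_def)
  have m: "(cmod \<mu>)\<^sup>2 = Re \<mu> * Re \<mu> + Im \<mu> * Im \<mu>" unfolding cmod_power2 by (simp add: power2_eq_square)
  have y0: "(modal_mat \<mu> r *\<^sub>v x) $ 0 = (Re r - Re \<mu> * q) * x $ 0 + q * x $ 1"
    using i[of 0] by (simp add: q_def)
  have y1: "(modal_mat \<mu> r *\<^sub>v x) $ 1 =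
      - (Re \<mu> * Re \<mu> + Im \<mu> * Im \<mu>) * q * x $ 0 + (Re r + Re \<mu> * q) * x $ 1"
    using i[of 1] by (simp add: q_def m)
  show ?thesis
    unfolding modal_def y0 y1 by (simp add: complex_eq_iff r algebra_simps)
qed

lemma mat2_mult_vec_ext:
  fixes D D' :: "real mat"
  assumes "D \<in> carrier_mat 2 2" "D' \<in> carrier_mat 2 2" "\<And>x. x \<in> carrier_vec 2 \<Longrightarrow> D *\<^sub>v x = D' *\<^sub>v x"
  shows "D = D'"
proof (rule eq_matI)
  fix i j assume ij: "i < dim_row D'" "j < dim_col D'"
  have "D *\<^sub>v unit_vec 2 j = D' *\<^sub>v unit_vec 2 j" by (rule assms(3)) simp
  then have "(D *\<^sub>v unit_vec 2 j) $ i = (D' *\<^sub>v unit_vec 2 j) $ i" by simp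
  then show "D $$ (i, j) = D' $$ (i, j)" using ij assms(1,2) by (simp add: scalar_prod_right_unit)
qed (use assms in auto)

text \<open>Turns a one-step formula in the modal coordinate into one for real vectors.\<close>
lemma affine_modal:
  assumes "Im \<mu> \<noteq> 0" "x \<in> carrier_vec 2" "y \<in> carrier_vec 2"
  shows "modal \<mu> y = r * modal \<mu> x + S \<longleftrightarrow> y = modal_mat \<mu> r *\<^sub>v x + unmodal \<mu> S"
proof -
  have c: "modal_mat \<mu> r *\<^sub>v x \<in> carrier_vec 2"
    using assms(2) by (rule mult_mat_vec_carrier[OF modal_mat_carrier])
  have "r * modal \<mu> x + S = modal \<mu> (modal_mat \<mu> r *\<^sub>v x + unmodal \<mu> S)"
    using assms c by (simp add: modal_linear modal_mat_mult modal_unmodal)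
  then show ?thesis using assms c by (simp add: modal_eq_iff)
qed

lemma char_poly_modal_mat:
  assumes "Im \<mu> \<noteq> 0"
  shows "char_poly (modal_mat \<mu> r) = [:(norm r)\<^sup>2, - 2 * Re r, 1:]"
proof -
  define q where "q = Im r / Im \<mu>"
  have q: "Im r = q * Im \<mu>" using assms by (simp add: q_def)
  have "modal_mat \<mu> r $$ (0, 0) * modal_mat \<mu> r $$ (1, 1) - modal_mat \<mu> r $$ (0, 1) * modal_mat \<mu> r $$ (1, 0) = (norm r)\<^sup>2"
    unfolding One_nat_def modal_mat_index q_def[symmetric] unfolding cmod_power2 q
    by (simp add: power2_eq_square algebra_simps)
  then show ?thesis by (simp add: char_poly_mat2)
qed

lemma spectral_radius_modal_mat:
  assumes "Im \<mu> \<noteq> 0"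
  shows "spectral_radius (map_mat complex_of_real (modal_mat \<mu> r)) = norm r"
proof -
  have c: "map_mat complex_of_real (modal_mat \<mu> r) \<in> carrier_mat 2 2" by simp
  have "char_poly (map_mat complex_of_real (modal_mat \<mu> r)) =
      map_poly complex_of_real (char_poly (modal_mat \<mu> r))"
    by (rule of_real_hom.char_poly_hom[OF modal_mat_carrier])
  also have "\<dots> = [:- r, 1:] * [:- cnj r, 1:]"
    unfolding char_poly_modal_mat[OF assms]
    using complex_norm_square[of r] by (simp add: complex_eq_iff)
  finally have "spectrum (map_mat complex_of_real (modal_mat \<mu> r)) = {r, cnj r}"
    unfolding spectrum_root_char_poly[OF c] by (auto simp only: poly_mult) auto
  then show ?thesis by (simp add: spectral_radius_def)
qed

lemma modal_vec_of_list: "modal \<mu> (vec_of_list [p, q]) = Complex (q - Re \<mu> * p) (Im \<mu> * p)"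
  by (simp add: modal_def complex_eq_iff)

text \<open>The acceleration belonging to \<open>(u, v)\<close> turns into the right hand side \<open>\<mu> w + F\<close>, because the sum of \<open>\<mu>\<close> and
  \<open>cnj \<mu>\<close> is \<open>- 2 \<xi> \<omega>\<close> and their product is \<open>\<omega>\<^sup>2\<close>. Both the method and the exact flow are reduced by it.\<close>
lemma modal_rhs:
  assumes "\<omega> > 0" "\<xi> \<in> {0..<1}" and \<mu>: "\<mu> = eig \<xi> \<omega>"
  shows "Complex ((F - 2 * \<xi> * \<omega> * v - \<omega>\<^sup>2 * u) - Re \<mu> * v) (Im \<mu> * v)
    = \<mu> * Complex (v - Re \<mu> * u) (Im \<mu> * u) + of_real F"
proof -
  note e = eig_props[OF assms(1,2), folded \<mu>]
  have r: "2 * \<xi> * \<omega> = - 2 * Re \<mu>" using e(2) by simp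
  have n: "\<omega>\<^sup>2 = (Re \<mu>)\<^sup>2 + (Im \<mu>)\<^sup>2" using e(3) by (simp add: cmod_power2)
  show ?thesis unfolding r n by (simp add: complex_eq_iff power2_eq_square algebra_simps)
qed

section \<open>The sub-step method in the modal coordinate\<close>

text \<open>The stages of the Runge-Kutta method for \<open>w\<close>, solved one after the other: \<open>z\<close> is the step size times the
  eigenvalue, \<open>g j\<close> the step size times the load at node \<open>j\<close>, and \<open>x\<close> the initial value. The division by zero at a
  pole of the stage only gives a default value.\<close>
fun stage :: "(nat \<Rightarrow> nat \<Rightarrow> real) \<Rightarrow> complex \<Rightarrow> (nat \<Rightarrow> complex) \<Rightarrow> complex \<Rightarrow> nat \<Rightarrow> complex" where
  "stage \<alpha> z g x i = (if i = 0 then x else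
     (x + (\<Sum>j<i. of_real (\<alpha> i j) * (z * stage \<alpha> z g x j + g j)) + of_real (\<alpha> i i) * g i)
       / (1 - of_real (\<alpha> i i) * z))"

declare stage.simps [simp del]

lemma stage_0 [simp]: "stage \<alpha> z g x 0 = x" by (simp add: stage.simps)

text \<open>By linearity the factor of the initial value is the stability function, the stage value for \<open>x = 1\<close> without load.\<close>
lemma stage_affine: "stage \<alpha> z g x i = stage \<alpha> z (\<lambda>_. 0) 1 i * x + stage \<alpha> z g 0 i"
proof (induction i rule: less_induct)
  case (less i)
  let ?A = "\<lambda>j. of_real (\<alpha> i j) :: complex"
  have "(\<Sum>j<i. ?A j * (z * stage \<alpha> z g x j + g j)) =
      (\<Sum>j<i. (?A j * (z * stage \<alpha> z (\<lambda>_. 0) 1 j)) * x + ?A j * (z * stage \<alpha> z g 0 j + g j))"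
  proof (rule sum.cong)
    fix j assume "j \<in> {..<i}"
    then have j: "j < i" by simp
    show "?A j * (z * stage \<alpha> z g x j + g j) =
        (?A j * (z * stage \<alpha> z (\<lambda>_. 0) 1 j)) * x + ?A j * (z * stage \<alpha> z g 0 j + g j)"
      unfolding less.IH[OF j] by (simp only: algebra_simps)
  qed simp
  also have "\<dots> = (\<Sum>j<i. ?A j * (z * stage \<alpha> z (\<lambda>_. 0) 1 j)) * x
      + (\<Sum>j<i. ?A j * (z * stage \<alpha> z g 0 j + g j))"
    by (simp add: sum.distrib sum_distrib_right)
  finally have eq: "(\<Sum>j<i. ?A j * (z * stage \<alpha> z g x j + g j)) = \<dots>" .
  show ?case
    unfolding stage.simps[of \<alpha> z g x i] stage.simps[of \<alpha> z "\<lambda>_. 0" 1 i] stage.simps[of \<alpha> z g 0 i]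
    unfolding eq by (simp add: add_divide_distrib ring_distribs)
qed

lemma stage_iff:
  assumes "\<forall>i\<in>{1..s}. 1 - of_real (\<alpha> i i) * z \<noteq> 0"
  shows "(\<forall>i\<in>{1..s}. w i = w 0 + (\<Sum>j=0..i. of_real (\<alpha> i j) * (z * w j + g j)))
    \<longleftrightarrow> (\<forall>i\<le>s. w i = stage \<alpha> z g (w 0) i)" (is "?L \<longleftrightarrow> ?R")
proof -
  have step: "w i = w 0 + (\<Sum>j=0..i. of_real (\<alpha> i j) * (z * w j + g j)) \<longleftrightarrow>
     w i = (w 0 + (\<Sum>j<i. of_real (\<alpha> i j) * (z * w j + g j)) + of_real (\<alpha> i i) * g i)
       / (1 - of_real (\<alpha> i i) * z)" if "i \<in> {1..s}" for i
  proof -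
    define S where "S = (\<Sum>j<i. of_real (\<alpha> i j) * (z * w j + g j))"
    have "{0..i} = insert i {..<i}" by auto
    then have "(\<Sum>j=0..i. of_real (\<alpha> i j) * (z * w j + g j)) = of_real (\<alpha> i i) * (z * w i + g i) + S"
      by (simp add: S_def)
    moreover have "w i = w 0 + (of_real (\<alpha> i i) * (z * w i + g i) + S) \<longleftrightarrow>
        w i * (1 - of_real (\<alpha> i i) * z) = w 0 + S + of_real (\<alpha> i i) * g i"
      unfolding eq_iff_diff_eq_0[of "w i"] eq_iff_diff_eq_0[of "w i * _"]
      by (rule arg_cong[of _ _ "\<lambda>t. t = 0"]) (simp add: algebra_simps)
    moreover have nz: "1 - of_real (\<alpha> i i) * z \<noteq> 0" using assms that by blast
    ultimately show ?thesis
      unfolding S_def[symmetric] by (simp only: nonzero_eq_divide_eq[OF nz])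
  qed
  show ?thesis
  proof
    assume L: ?L
    show ?R
    proof (intro allI impI)
      fix i assume "i \<le> s"
      then show "w i = stage \<alpha> z g (w 0) i"
      proof (induction i rule: less_induct)
        case (less i)
        show ?case
        proof (cases "i = 0")
          case False
          then have i: "i \<in> {1..s}" using less.prems by simp
          have "w i = (w 0 + (\<Sum>j<i. of_real (\<alpha> i j) * (z * w j + g j)) + of_real (\<alpha> i i) * g i)
              / (1 - of_real (\<alpha> i i) * z)" by (rule iffD1[OF step[OF i] bspec[OF L i]])
          also have "(\<Sum>j<i. of_real (\<alpha> i j) * (z * w j + g j)) =
              (\<Sum>j<i. of_real (\<alpha> i j) * (z * stage \<alpha> z g (w 0) j + g j))"
          proof (rule sum.cong)
            fix j assume "j \<in> {..<i}"
            then have "j < i" "j \<le> s" using less.prems by auto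
            from less.IH[OF this] show "of_real (\<alpha> i j) * (z * w j + g j) =
                of_real (\<alpha> i j) * (z * stage \<alpha> z g (w 0) j + g j)" by (rule arg_cong)
          qed simp
          finally show ?thesis using False by (simp add: stage.simps[of _ _ _ _ i])
        qed simp
      qed
    qed
  next
    assume R: ?R
    show ?L
    proof
      fix i assume i: "i \<in> {1..s}"
      have "w i = (w 0 + (\<Sum>j<i. of_real (\<alpha> i j) * (z * stage \<alpha> z g (w 0) j + g j)) + of_real (\<alpha> i i) * g i)
              / (1 - of_real (\<alpha> i i) * z)" using i by (subst R[rule_format, of i]) (simp_all add: stage.simps[of _ _ _ _ i])
      also have "(\<Sum>j<i. of_real (\<alpha> i j) * (z * stage \<alpha> z g (w 0) j + g j)) =
         (\<Sum>j<i. of_real (\<alpha> i j) * (z * w j + g j))"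
      proof (rule sum.cong)
        fix j assume "j \<in> {..<i}"
        then have "j \<le> s" using i by auto
        from R[rule_format, OF this] show "of_real (\<alpha> i j) * (z * stage \<alpha> z g (w 0) j + g j) =
            of_real (\<alpha> i j) * (z * w j + g j)" by (rule arg_cong[OF sym])
      qed simp
      finally show "w i = w 0 + (\<Sum>j=0..i. of_real (\<alpha> i j) * (z * w j + g j))" by (rule iffD2[OF step[OF i]])
    qed
  qed
qed

text \<open>The definite descriptions are resolved here: an affine map determines its linear part and its
  constant.\<close>
lemma num_eq_of_modal_step:
  assumes "Im \<mu> \<noteq> 0"
    and step: "\<And>f tn x y. x \<in> carrier_vec 2 \<Longrightarrow> y \<in> carrier_vec 2 \<Longrightarrow>
      substep_step s \<alpha> \<gamma> \<xi> \<omega> f tn dt x y \<longleftrightarrow> modal \<mu> y = r * modal \<mu> x + S f tn"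
  shows "D_num s \<alpha> \<gamma> \<xi> \<omega> dt = modal_mat \<mu> r"
    and "L_num s \<alpha> \<gamma> \<xi> \<omega> f tn dt = unmodal \<mu> (S f tn)"
proof -
  have step': "substep_step s \<alpha> \<gamma> \<xi> \<omega> f tn dt x y \<longleftrightarrow> y = modal_mat \<mu> r *\<^sub>v x + unmodal \<mu> (S f tn)"
    if "x \<in> carrier_vec 2" "y \<in> carrier_vec 2" for f tn x y
    using step[OF that] affine_modal[OF assms(1) that] by simp
  have uniq: "D = modal_mat \<mu> r \<and> L = unmodal \<mu> (S f tn)"
    if D: "D \<in> carrier_mat 2 2" and L: "L \<in> carrier_vec 2"
      and st: "\<forall>x\<in>carrier_vec 2. \<forall>y\<in>carrier_vec 2.
           substep_step s \<alpha> \<gamma> \<xi> \<omega> f tn dt x y \<longleftrightarrow> y = D *\<^sub>v x + L" for D L f tn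
  proof -
    have eq: "D *\<^sub>v x + L = modal_mat \<mu> r *\<^sub>v x + unmodal \<mu> (S f tn)" if x: "x \<in> carrier_vec 2" for x
    proof -
      have "D *\<^sub>v x + L \<in> carrier_vec 2" using D L x by auto
      then show ?thesis using st step'[OF x] x by blast
    qed
    have z: "M *\<^sub>v 0\<^sub>v 2 = 0\<^sub>v 2" if "M \<in> carrier_mat 2 2" for M :: "real mat"
      using that by (intro eq_vecI) (auto simp: mult_mat_vec_def)
    have LL: "L = unmodal \<mu> (S f tn)"
      using eq[of "0\<^sub>v 2"] D L z[OF D] z[OF modal_mat_carrier] by simp
    have "D *\<^sub>v x = modal_mat \<mu> r *\<^sub>v x" if x: "x \<in> carrier_vec 2" for x
    proof -
      have c: "D *\<^sub>v x \<in> carrier_vec 2" "modal_mat \<mu> r *\<^sub>v x \<in> carrier_vec 2"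
        using D x modal_mat_carrier by (auto intro: mult_mat_vec_carrier simp del: modal_mat_carrier)
      have "D *\<^sub>v x + unmodal \<mu> (S f tn) = modal_mat \<mu> r *\<^sub>v x + unmodal \<mu> (S f tn)"
        using eq[OF x] unfolding LL .
      from arg_cong[OF this, of "\<lambda>v. v $ 0"] arg_cong[OF this, of "\<lambda>v. v $ 1"]
      show ?thesis unfolding vec2_eq_iff[OF c] by simp
    qed
    then have "D = modal_mat \<mu> r" by (rule mat2_mult_vec_ext[OF D modal_mat_carrier])
    then show ?thesis using LL by simp
  qed
  show D: "D_num s \<alpha> \<gamma> \<xi> \<omega> dt = modal_mat \<mu> r"
    unfolding D_num_def
  proof (rule the_equality, intro conjI allI)
    fix f tn
    show "\<exists>L\<in>carrier_vec 2. \<forall>x\<in>carrier_vec 2. \<forall>y\<in>carrier_vec 2.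
           substep_step s \<alpha> \<gamma> \<xi> \<omega> f tn dt x y \<longleftrightarrow> y = modal_mat \<mu> r *\<^sub>v x + L"
      using step' by (intro bexI[of _ "unmodal \<mu> (S f tn)"]) auto
  next
    fix D assume D: "D \<in> carrier_mat 2 2 \<and> (\<forall>f tn. \<exists>L\<in>carrier_vec 2. \<forall>x\<in>carrier_vec 2. \<forall>y\<in>carrier_vec 2.
           substep_step s \<alpha> \<gamma> \<xi> \<omega> f tn dt x y \<longleftrightarrow> y = D *\<^sub>v x + L)"
    then obtain L where "L \<in> carrier_vec 2" "\<forall>x\<in>carrier_vec 2. \<forall>y\<in>carrier_vec 2.
           substep_step s \<alpha> \<gamma> \<xi> \<omega> f tn dt x y \<longleftrightarrow> y = D *\<^sub>v x + L" by blast
    with D show "D = modal_mat \<mu> r" using uniq by blast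
  qed (rule modal_mat_carrier)
  show "L_num s \<alpha> \<gamma> \<xi> \<omega> f tn dt = unmodal \<mu> (S f tn)"
    unfolding L_num_def D
  proof (rule the_equality)
    show "unmodal \<mu> (S f tn) \<in> carrier_vec 2 \<and> (\<forall>x\<in>carrier_vec 2. \<forall>y\<in>carrier_vec 2.
       substep_step s \<alpha> \<gamma> \<xi> \<omega> f tn dt x y \<longleftrightarrow> y = modal_mat \<mu> r *\<^sub>v x + unmodal \<mu> (S f tn))"
      using step' by simp
  qed (use uniq[OF modal_mat_carrier] in blast)
qed

text \<open>A stage pair of displacement and velocity equations is one complex equation. Its real and imaginary parts
  give back the pair because \<open>Im \<mu>\<close> is not zero.\<close>
lemma substep_step_modal:
  assumes w: "\<omega> > 0" and xi: "\<xi> \<in> {0..<1}" and \<mu>: "\<mu> = eig \<xi> \<omega>" and g0: "\<gamma> 0 = 0"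
    and xy: "x \<in> carrier_vec 2" "y \<in> carrier_vec 2"
  shows "substep_step s \<alpha> \<gamma> \<xi> \<omega> f tn dt x y \<longleftrightarrow>
    (\<exists>w. w 0 = modal \<mu> x \<and> w s = modal \<mu> y \<and> (\<forall>i\<in>{1..s}. w i = w 0 +
       (\<Sum>j=0..i. of_real (\<alpha> i j) * (of_real dt * \<mu> * w j + of_real (dt * f (tn + \<gamma> j * dt))))))"
proof -
  note e = eig_props[OF w xi, folded \<mu>]
  define \<rho> \<sigma> where "\<rho> = Re \<mu>" and "\<sigma> = Im \<mu>"
  have s0: "\<sigma> \<noteq> 0" using e(1) by (simp add: \<sigma>_def)
  have acc: "Complex (a - \<rho> * v) (\<sigma> * v) = \<mu> * Complex (v - \<rho> * u) (\<sigma> * u) + of_real F"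
    if "a = F - 2 * \<xi> * \<omega> * v - \<omega>\<^sup>2 * u" for u v a F
    unfolding that \<rho>_def \<sigma>_def by (rule modal_rhs[OF w xi \<mu>])
  have main: "u i = u 0 + dt * (\<Sum>j=0..i. \<alpha> i j * v j) \<and> v i = v 0 + dt * (\<Sum>j=0..i. \<alpha> i j * a j)
      \<longleftrightarrow> Complex (v i - \<rho> * u i) (\<sigma> * u i) = Complex (v 0 - \<rho> * u 0) (\<sigma> * u 0) +
       (\<Sum>j=0..i. of_real (\<alpha> i j) * (of_real dt * \<mu> * Complex (v j - \<rho> * u j) (\<sigma> * u j) + of_real (dt * F j)))"
    if "\<And>j. j \<le> i \<Longrightarrow> a j = F j - 2 * \<xi> * \<omega> * v j - \<omega>\<^sup>2 * u j" for u v a F :: "nat \<Rightarrow> real" and i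
  proof -
    have "(\<Sum>j=0..i. of_real (\<alpha> i j) * (of_real dt * \<mu> * Complex (v j - \<rho> * u j) (\<sigma> * u j) + of_real (dt * F j)))
       = of_real dt * (\<Sum>j=0..i. of_real (\<alpha> i j) * Complex (a j - \<rho> * v j) (\<sigma> * v j))"
      unfolding sum_distrib_left by (rule sum.cong) (simp_all add: acc[OF that] algebra_simps)
    also have "\<dots> = Complex (dt * (\<Sum>j=0..i. \<alpha> i j * a j) - \<rho> * (dt * (\<Sum>j=0..i. \<alpha> i j * v j)))
         (\<sigma> * (dt * (\<Sum>j=0..i. \<alpha> i j * v j)))"
      by (simp add: complex_eq_iff sum_distrib_left sum_subtractf[symmetric] algebra_simps)
    finally have eq: "(\<Sum>j=0..i. of_real (\<alpha> i j) * (of_real dt * \<mu> * Complex (v j - \<rho> * u j) (\<sigma> * u j) + of_real (dt * F j))) = \<dots>" .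
    define U V where "U = dt * (\<Sum>j=0..i. \<alpha> i j * v j)" and "V = dt * (\<Sum>j=0..i. \<alpha> i j * a j)"
    have "\<sigma> * u i = \<sigma> * u 0 + \<sigma> * U \<longleftrightarrow> u i = u 0 + U"
      unfolding distrib_left[symmetric] using s0 by simp
    moreover have "v i - \<rho> * u i = v 0 - \<rho> * u 0 + (V - \<rho> * U) \<longleftrightarrow> v i = v 0 + V" if "u i = u 0 + U"
      unfolding that by (auto simp: algebra_simps)
    ultimately show ?thesis unfolding eq U_def[symmetric] V_def[symmetric] complex_eq_iff plus_complex.sel complex.sel
      by blast
  qed
  have vl: "z = vec_of_list [p, q] \<longleftrightarrow> Complex (q - \<rho> * p) (\<sigma> * p) = modal \<mu> z"
    if "z \<in> carrier_vec 2" for z p q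
  proof -
    have "vec_of_list [p, q] \<in> carrier_vec 2" by (rule carrier_vecI) simp
    moreover have "Im \<mu> \<noteq> 0" using s0 by (simp add: \<sigma>_def)
    ultimately show ?thesis
      unfolding \<rho>_def \<sigma>_def modal_vec_of_list[symmetric] using modal_eq_iff that by metis
  qed
  show ?thesis
  proof
    assume "substep_step s \<alpha> \<gamma> \<xi> \<omega> f tn dt x y"
    then obtain u v a where
      x: "x = vec_of_list [u 0, v 0]" and a0: "a 0 = f tn - 2 * \<xi> * \<omega> * v 0 - \<omega>\<^sup>2 * u 0" and
      st: "\<forall>i\<in>{1..s}. a i + 2 * \<xi> * \<omega> * v i + \<omega>\<^sup>2 * u i = f (tn + \<gamma> i * dt) \<and>
           u i = u 0 + dt * (\<Sum>j=0..i. \<alpha> i j * v j) \<and> v i = v 0 + dt * (\<Sum>j=0..i. \<alpha> i j * a j)"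
      and y: "y = vec_of_list [u s, v s]" unfolding substep_step_def by blast
    have a: "a j = f (tn + \<gamma> j * dt) - 2 * \<xi> * \<omega> * v j - \<omega>\<^sup>2 * u j" if "j \<le> s" for j
    proof (cases "j = 0")
      case False
      then have "a j + 2 * \<xi> * \<omega> * v j + \<omega>\<^sup>2 * u j = f (tn + \<gamma> j * dt)"
        using conjunct1[OF bspec[OF st, of j]] that by simp
      then show ?thesis by linarith
    qed (simp add: a0 g0)
    show "\<exists>w. w 0 = modal \<mu> x \<and> w s = modal \<mu> y \<and> (\<forall>i\<in>{1..s}. w i = w 0 +
       (\<Sum>j=0..i. of_real (\<alpha> i j) * (of_real dt * \<mu> * w j + of_real (dt * f (tn + \<gamma> j * dt)))))"
    proof (intro exI[of _ "\<lambda>i. Complex (v i - \<rho> * u i) (\<sigma> * u i)"] conjI ballI)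
      fix i assume i: "i \<in> {1..s}"
      show "Complex (v i - \<rho> * u i) (\<sigma> * u i) = Complex (v 0 - \<rho> * u 0) (\<sigma> * u 0) +
       (\<Sum>j=0..i. of_real (\<alpha> i j) * (of_real dt * \<mu> * Complex (v j - \<rho> * u j) (\<sigma> * u j) +
          of_real (dt * f (tn + \<gamma> j * dt))))"
        by (rule iffD1[OF main[of i a]]) (use a i in simp, use bspec[OF st i] in blast)
    qed (use vl[OF xy(1)] vl[OF xy(2)] x y in blast)+
  next
    assume "\<exists>w. w 0 = modal \<mu> x \<and> w s = modal \<mu> y \<and> (\<forall>i\<in>{1..s}. w i = w 0 +
       (\<Sum>j=0..i. of_real (\<alpha> i j) * (of_real dt * \<mu> * w j + of_real (dt * f (tn + \<gamma> j * dt)))))"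
    then obtain w where w: "w 0 = modal \<mu> x" "w s = modal \<mu> y" "\<forall>i\<in>{1..s}. w i = w 0 +
       (\<Sum>j=0..i. of_real (\<alpha> i j) * (of_real dt * \<mu> * w j + of_real (dt * f (tn + \<gamma> j * dt))))" by blast
    define u where "u = (\<lambda>i. Im (w i) / \<sigma>)"
    define v where "v = (\<lambda>i. Re (w i) + \<rho> * u i)"
    define a where "a = (\<lambda>j. f (tn + \<gamma> j * dt) - 2 * \<xi> * \<omega> * v j - \<omega>\<^sup>2 * u j)"
    have w': "Complex (v i - \<rho> * u i) (\<sigma> * u i) = w i" for i
      using s0 by (simp add: u_def v_def complex_eq_iff)
    have st: "u i = u 0 + dt * (\<Sum>j=0..i. \<alpha> i j * v j) \<and> v i = v 0 + dt * (\<Sum>j=0..i. \<alpha> i j * a j)"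
      if i: "i \<in> {1..s}" for i
      by (rule iffD2[OF main[of i a "\<lambda>j. f (tn + \<gamma> j * dt)" v u]]) (simp only: a_def, use bspec[OF w(3) i] in \<open>simp only: w'\<close>)
    show "substep_step s \<alpha> \<gamma> \<xi> \<omega> f tn dt x y"
      unfolding substep_step_def
    proof (rule exI[of _ u], rule exI[of _ v], rule exI[of _ a], intro conjI ballI)
      show "x = vec_of_list [u 0, v 0]" "y = vec_of_list [u s, v s]"
        using vl[OF xy(1), of "u 0" "v 0"] vl[OF xy(2), of "u s" "v s"] w(1,2) unfolding w' by auto
    qed (simp add: a_def g0, simp add: a_def, use st in blast, use st in blast)
  qed
qed

lemma num_eq:
  assumes w: "\<omega> > 0" and xi: "\<xi> \<in> {0..<1}" and g0: "\<gamma> 0 = 0"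
  defines "\<mu> \<equiv> eig \<xi> \<omega>"
  shows "D_num s \<alpha> \<gamma> \<xi> \<omega> dt = modal_mat \<mu> (stage \<alpha> (of_real dt * \<mu>) (\<lambda>_. 0) 1 s)"
    and "L_num s \<alpha> \<gamma> \<xi> \<omega> f tn dt =
      unmodal \<mu> (stage \<alpha> (of_real dt * \<mu>) (\<lambda>j. of_real (dt * f (tn + \<gamma> j * dt))) 0 s)"
proof -
  note e = eig_props[OF w xi, folded \<mu>_def]
  have nz: "1 - of_real c * (of_real dt * \<mu>) \<noteq> 0" for c
    using e(1) by (auto simp: complex_eq_iff)
  have nzs: "\<forall>i\<in>{1..s}. 1 - of_real (\<alpha> i i) * (of_real dt * \<mu>) \<noteq> 0" using nz by blast
  have st: "substep_step s \<alpha> \<gamma> \<xi> \<omega> f tn dt x y \<longleftrightarrow> modal \<mu> y =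
     stage \<alpha> (of_real dt * \<mu>) (\<lambda>_. 0) 1 s * modal \<mu> x +
     stage \<alpha> (of_real dt * \<mu>) (\<lambda>j. of_real (dt * f (tn + \<gamma> j * dt))) 0 s"
    if "x \<in> carrier_vec 2" "y \<in> carrier_vec 2" for f tn x y
  proof -
    let ?g = "\<lambda>j. complex_of_real (dt * f (tn + \<gamma> j * dt))"
    have "substep_step s \<alpha> \<gamma> \<xi> \<omega> f tn dt x y \<longleftrightarrow> (\<exists>w. w 0 = modal \<mu> x \<and> w s = modal \<mu> y \<and>
        (\<forall>i\<le>s. w i = stage \<alpha> (of_real dt * \<mu>) ?g (w 0) i))"
      unfolding substep_step_modal[where \<mu> = \<mu> and \<gamma> = \<gamma> and \<omega> = \<omega> and \<xi> = \<xi>, OF w xi \<mu>_def[THEN meta_eq_to_obj_eq] g0 that]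
      by (simp only: stage_iff[where \<alpha> = \<alpha> and z = "of_real dt * \<mu>" and g = ?g, OF nzs])
    also have "\<dots> \<longleftrightarrow> modal \<mu> y = stage \<alpha> (of_real dt * \<mu>) ?g (modal \<mu> x) s"
    proof
      assume "modal \<mu> y = stage \<alpha> (of_real dt * \<mu>) ?g (modal \<mu> x) s"
      then show "\<exists>w. w 0 = modal \<mu> x \<and> w s = modal \<mu> y \<and>
        (\<forall>i\<le>s. w i = stage \<alpha> (of_real dt * \<mu>) ?g (w 0) i)"
        by (intro exI[of _ "stage \<alpha> (of_real dt * \<mu>) ?g (modal \<mu> x)"]) simp
    next
      assume "\<exists>w. w 0 = modal \<mu> x \<and> w s = modal \<mu> y \<and>
        (\<forall>i\<le>s. w i = stage \<alpha> (of_real dt * \<mu>) ?g (w 0) i)"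
      then obtain w where "w 0 = modal \<mu> x" "w s = modal \<mu> y"
        "w s = stage \<alpha> (of_real dt * \<mu>) ?g (w 0) s" by blast
      then show "modal \<mu> y = stage \<alpha> (of_real dt * \<mu>) ?g (modal \<mu> x) s" by (simp only:)
    qed
    finally show ?thesis unfolding stage_affine[of \<alpha> _ ?g "modal \<mu> x"] .
  qed
  let ?S = "\<lambda>f tn. stage \<alpha> (of_real dt * \<mu>) (\<lambda>j. of_real (dt * f (tn + \<gamma> j * dt))) 0 s"
  have im: "Im \<mu> \<noteq> 0" using e(1) by simp
  show "D_num s \<alpha> \<gamma> \<xi> \<omega> dt = modal_mat \<mu> (stage \<alpha> (of_real dt * \<mu>) (\<lambda>_. 0) 1 s)"
    by (rule num_eq_of_modal_step(1)[where S = ?S, OF im]) (rule st)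
  show "L_num s \<alpha> \<gamma> \<xi> \<omega> f tn dt = unmodal \<mu> (?S f tn)"
    by (rule num_eq_of_modal_step(2)[where S = ?S, OF im]) (rule st)
qed

section \<open>The exact flow in the modal coordinate\<close>

lemma exact_step_modal:
  assumes w: "\<omega> > 0" "\<xi> \<in> {0..<1}" and \<mu>: "\<mu> = eig \<xi> \<omega>"
    and xy: "x \<in> carrier_vec 2" "y \<in> carrier_vec 2"
  shows "exact_step \<xi> \<omega> f 0 dt x y \<longleftrightarrow> (\<exists>w. w 0 = modal \<mu> x \<and> w dt = modal \<mu> y \<and>
    (\<forall>t\<in>{0..dt}. (w has_vector_derivative \<mu> * w t + of_real (f t)) (at t within {0..dt})))"
proof -
  have im: "Im \<mu> \<noteq> 0" using eig_props(1)[OF w] \<mu> by simp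
  show ?thesis
  proof
    assume "exact_step \<xi> \<omega> f 0 dt x y"
    then obtain u v where x: "x = vec_of_list [u 0, v 0]" and y: "y = vec_of_list [u dt, v dt]"
      and d: "\<And>t. t \<in> {0..dt} \<Longrightarrow> (u has_real_derivative v t) (at t within {0..dt})"
         "\<And>t. t \<in> {0..dt} \<Longrightarrow> (v has_real_derivative f t - 2 * \<xi> * \<omega> * v t - \<omega>\<^sup>2 * u t) (at t within {0..dt})"
      unfolding exact_step_def by auto
    let ?w = "\<lambda>t. Complex (v t - Re \<mu> * u t) (Im \<mu> * u t)"
    show "\<exists>w. w 0 = modal \<mu> x \<and> w dt = modal \<mu> y \<and>
      (\<forall>t\<in>{0..dt}. (w has_vector_derivative \<mu> * w t + of_real (f t)) (at t within {0..dt}))"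
    proof (rule exI[of _ ?w], intro conjI ballI)
      fix t assume t: "t \<in> {0..dt}"
      show "(?w has_vector_derivative \<mu> * ?w t + of_real (f t)) (at t within {0..dt})"
        unfolding modal_rhs[OF w \<mu>, symmetric] has_vector_derivative_complex_iff complex.sel
        using d[OF t] by (auto intro!: derivative_eq_intros)
    qed (simp_all only: x y modal_vec_of_list)
  next
    assume "\<exists>w. w 0 = modal \<mu> x \<and> w dt = modal \<mu> y \<and>
      (\<forall>t\<in>{0..dt}. (w has_vector_derivative \<mu> * w t + of_real (f t)) (at t within {0..dt}))"
    then obtain w where w0: "w 0 = modal \<mu> x" and w1: "w dt = modal \<mu> y" and
      d: "\<And>t. t \<in> {0..dt} \<Longrightarrow> (w has_vector_derivative \<mu> * w t + of_real (f t)) (at t within {0..dt})" by blast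
    define u where "u = (\<lambda>t. Im (w t) / Im \<mu>)"
    define v where "v = (\<lambda>t. Re (w t) + Re \<mu> * u t)"
    have w': "w t = Complex (v t - Re \<mu> * u t) (Im \<mu> * u t)" for t
      using im by (simp add: u_def v_def complex_eq_iff)
    have "unmodal \<mu> (w t) = vec_of_list [u t, v t]" for t by (simp add: unmodal_def u_def v_def)
    moreover have "z = unmodal \<mu> (modal \<mu> z)" if "z \<in> carrier_vec 2" for z
      using modal_eq_iff[OF im that unmodal_carrier] modal_unmodal[OF im] by metis
    ultimately have "x = vec_of_list [u 0, v 0]" "y = vec_of_list [u dt, v dt]"
      using w0 w1 xy by metis+
    moreover have "(u has_real_derivative v t) (at t within {0..dt}) \<and>
        (v has_real_derivative f t - 2 * \<xi> * \<omega> * v t - \<omega>\<^sup>2 * u t) (at t within {0..dt})"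
      if t: "t \<in> {0..dt}" for t
    proof -
      let ?a = "f t - 2 * \<xi> * \<omega> * v t - \<omega>\<^sup>2 * u t"
      have "\<mu> * w t + of_real (f t) = Complex (?a - Re \<mu> * v t) (Im \<mu> * v t)"
        unfolding modal_rhs[OF w \<mu>] w' ..
      with d[OF t] have dw: "((\<lambda>t. Re (w t)) has_real_derivative ?a - Re \<mu> * v t) (at t within {0..dt})"
        "((\<lambda>t. Im (w t)) has_real_derivative Im \<mu> * v t) (at t within {0..dt})"
        by (simp_all add: has_vector_derivative_complex_iff)
      have du: "(u has_real_derivative v t) (at t within {0..dt})"
        unfolding u_def using DERIV_cdivide[OF dw(2), of "Im \<mu>"] im by simp
      have "((\<lambda>t. Re (w t) + Re \<mu> * u t) has_real_derivative (?a - Re \<mu> * v t) + Re \<mu> * v t) (at t within {0..dt})"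
        by (intro DERIV_add dw DERIV_cmult du)
      then show ?thesis using du unfolding v_def[symmetric] by simp
    qed
    ultimately show "exact_step \<xi> \<omega> f 0 dt x y"
      unfolding exact_step_def by - (rule exI[of _ u], rule exI[of _ v], simp)
  qed
qed

text \<open>Variation of constants: \<open>exp (- t \<mu>) (w t - w0 t)\<close> has derivative zero.\<close>
lemma linear_ode_unique:
  fixes w w0 g :: "real \<Rightarrow> complex"
  assumes "d \<ge> 0"
    and w: "\<And>t. t \<in> {0..d} \<Longrightarrow> (w has_vector_derivative \<mu> * w t + g t) (at t within {0..d})"
    and w0: "\<And>t. t \<in> {0..d} \<Longrightarrow> (w0 has_vector_derivative \<mu> * w0 t + g t) (at t within {0..d})" "w0 0 = 0"
  shows "w d = exp (of_real d * \<mu>) * w 0 + w0 d"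
proof -
  let ?\<phi> = "\<lambda>t. exp (t *\<^sub>R (- \<mu>)) * (w t - w0 t)"
  have "(?\<phi> has_vector_derivative 0) (at t within {0..d})" if t: "t \<in> {0..d}" for t
  proof -
    have "(?\<phi> has_vector_derivative exp (t *\<^sub>R (- \<mu>)) * ((\<mu> * w t + g t) - (\<mu> * w0 t + g t))
      + (exp (t *\<^sub>R (- \<mu>)) * (- \<mu>)) * (w t - w0 t)) (at t within {0..d})"
      by (intro has_vector_derivative_mult has_vector_derivative_diff w w0 t
          exp_scaleR_has_vector_derivative_right)
    then show ?thesis by (simp add: algebra_simps)
  qed
  moreover have "convex {0..d}" by (simp add: convex_real_interval)
  ultimately obtain c where c: "\<And>t. t \<in> {0..d} \<Longrightarrow> ?\<phi> t = c"
    using has_vector_derivative_zero_constant[of "{0..d}" ?\<phi>] by blast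
  have "?\<phi> d = ?\<phi> 0" using c[of d] c[of 0] assms(1) by simp
  then have "exp (of_real d * \<mu>) * (exp (- (of_real d * \<mu>)) * (w d - w0 d)) = exp (of_real d * \<mu>) * w 0"
    using w0(2) by (simp add: scaleR_conv_of_real)
  then have "w d - w0 d = exp (of_real d * \<mu>) * w 0"
    by (simp add: mult.assoc[symmetric] exp_minus)
  then show ?thesis by (simp add: algebra_simps)
qed

lemma has_vector_derivative_exp_mult:
  "((\<lambda>t. exp (complex_of_real t * \<mu>)) has_vector_derivative \<mu> * exp (of_real t * \<mu>)) (at t within S)"
  using exp_scaleR_has_vector_derivative_left[of \<mu> t]
  by (simp add: scaleR_conv_of_real has_vector_derivative_at_within)

lemma exact_step_affine:
  assumes w: "\<omega> > 0" "\<xi> \<in> {0..<1}" and \<mu>: "\<mu> = eig \<xi> \<omega>"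
    and xy: "x \<in> carrier_vec 2" "y \<in> carrier_vec 2" and "dt \<ge> 0"
    and w0: "\<And>t. (w0 has_vector_derivative \<mu> * w0 t + of_real (f t)) (at t within {0..dt})" "w0 0 = 0"
  shows "exact_step \<xi> \<omega> f 0 dt x y \<longleftrightarrow> modal \<mu> y = exp (of_real dt * \<mu>) * modal \<mu> x + w0 dt"
  unfolding exact_step_modal[OF w \<mu> xy]
proof
  assume "\<exists>w. w 0 = modal \<mu> x \<and> w dt = modal \<mu> y \<and>
    (\<forall>t\<in>{0..dt}. (w has_vector_derivative \<mu> * w t + of_real (f t)) (at t within {0..dt}))"
  then obtain w where "w 0 = modal \<mu> x" "w dt = modal \<mu> y"
    "\<And>t. t \<in> {0..dt} \<Longrightarrow> (w has_vector_derivative \<mu> * w t + of_real (f t)) (at t within {0..dt})" by blast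
  with linear_ode_unique[OF \<open>dt \<ge> 0\<close> this(3) w0]
  show "modal \<mu> y = exp (of_real dt * \<mu>) * modal \<mu> x + w0 dt" by metis
next
  assume y: "modal \<mu> y = exp (of_real dt * \<mu>) * modal \<mu> x + w0 dt"
  let ?w = "\<lambda>t. exp (of_real t * \<mu>) * modal \<mu> x + w0 t"
  have "(?w has_vector_derivative \<mu> * ?w t + of_real (f t)) (at t within {0..dt})" for t
  proof -
    have "(?w has_vector_derivative (\<mu> * exp (of_real t * \<mu>)) * modal \<mu> x + (\<mu> * w0 t + of_real (f t)))
       (at t within {0..dt})"
      by (intro has_vector_derivative_add has_vector_derivative_mult_left has_vector_derivative_exp_mult w0)
    then show ?thesis by (simp add: algebra_simps)
  qed
  then show "\<exists>w. w 0 = modal \<mu> x \<and> w dt = modal \<mu> y \<and>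
    (\<forall>t\<in>{0..dt}. (w has_vector_derivative \<mu> * w t + of_real (f t)) (at t within {0..dt}))"
    using y w0(2) by (intro exI[of _ ?w]) simp
qed

text \<open>For the load \<open>exp\<close> the particular solution with value zero at \<open>0\<close> is \<open>(exp t - exp (\<mu> t)) / (1 - \<mu>)\<close>; there is no
  resonance as \<open>\<mu>\<close> is not real.\<close>
lemma exa_eq:
  assumes w: "\<omega> > 0" "\<xi> \<in> {0..<1}" and dt: "dt \<ge> 0"
  defines "\<mu> \<equiv> eig \<xi> \<omega>"
  shows "D_exa \<xi> \<omega> dt = modal_mat \<mu> (exp (of_real dt * \<mu>))"
    and "L_exa \<xi> \<omega> dt = unmodal \<mu> ((exp (of_real dt) - exp (of_real dt * \<mu>)) / (1 - \<mu>))"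
proof -
  note \<mu> = \<mu>_def[THEN meta_eq_to_obj_eq]
  have im: "Im \<mu> \<noteq> 0" using eig_props(1)[OF w] \<mu> by simp
  have 1: "1 - \<mu> \<noteq> 0" using im by (auto simp: complex_eq_iff)
  have D: "exact_step \<xi> \<omega> (\<lambda>t. 0) 0 dt x y \<longleftrightarrow> y = modal_mat \<mu> (exp (of_real dt * \<mu>)) *\<^sub>v x"
    if x: "x \<in> carrier_vec 2" and y: "y \<in> carrier_vec 2" for x y
  proof -
    have c: "modal_mat \<mu> (exp (of_real dt * \<mu>)) *\<^sub>v x \<in> carrier_vec 2"
      using x by (rule mult_mat_vec_carrier[OF modal_mat_carrier])
    show ?thesis
      using exact_step_affine[OF w \<mu> x y dt, of "\<lambda>_. 0" "\<lambda>_. 0"] modal_eq_iff[OF im y c]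
        modal_mat_mult[OF im x] by simp
  qed
  show "D_exa \<xi> \<omega> dt = modal_mat \<mu> (exp (of_real dt * \<mu>))"
    unfolding D_exa_def
  proof (rule the_equality)
    fix D' assume D': "D' \<in> carrier_mat 2 2 \<and> (\<forall>x\<in>carrier_vec 2. \<forall>y\<in>carrier_vec 2.
           exact_step \<xi> \<omega> (\<lambda>t. 0) 0 dt x y \<longleftrightarrow> y = D' *\<^sub>v x)"
    show "D' = modal_mat \<mu> (exp (of_real dt * \<mu>))"
    proof (rule mat2_mult_vec_ext)
      fix x :: "real vec" assume x: "x \<in> carrier_vec 2"
      have "D' *\<^sub>v x \<in> carrier_vec 2" using D' x by auto
      then show "D' *\<^sub>v x = modal_mat \<mu> (exp (of_real dt * \<mu>)) *\<^sub>v x"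
        using D' D[OF x] x by blast
    qed (use D' in simp_all)
  qed (simp add: D)
  let ?w = "\<lambda>t. (exp (of_real t) - exp (of_real t * \<mu>)) / (1 - \<mu>)"
  have dw: "(?w has_vector_derivative \<mu> * ?w t + of_real (exp t)) (at t within {0..dt})" for t
  proof -
    have "(?w has_vector_derivative (exp (of_real t) - \<mu> * exp (of_real t * \<mu>)) / (1 - \<mu>)) (at t within {0..dt})"
      by (intro has_vector_derivative_divide has_vector_derivative_diff has_vector_derivative_exp_mult)
        (use has_vector_derivative_exp_mult[of 1 t] in simp)
    also have "(exp (of_real t) - \<mu> * exp (of_real t * \<mu>)) / (1 - \<mu>) = \<mu> * ?w t + of_real (exp t)"
      using 1 by (simp add: field_simps exp_of_real)
    finally show ?thesis .
  qed
  have m0: "modal \<mu> (0\<^sub>v 2) = 0" by (simp add: modal_def)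
  have L: "exact_step \<xi> \<omega> exp 0 dt (0\<^sub>v 2) y \<longleftrightarrow> y = unmodal \<mu> (?w dt)" if "y \<in> carrier_vec 2" for y
    using exact_step_affine[OF w \<mu> _ that dt dw] m0
      modal_eq_iff[OF im that unmodal_carrier[of \<mu> "?w dt"], unfolded modal_unmodal[OF im]]
    by simp
  have carr: "y \<in> carrier_vec 2" if "exact_step \<xi> \<omega> exp 0 dt (0\<^sub>v 2) y" for y
    using that unfolding exact_step_def by (auto intro!: carrier_vecI)
  show "L_exa \<xi> \<omega> dt = unmodal \<mu> (?w dt)"
    unfolding L_exa_def by (rule the_equality) (use L carr in auto)
qed

section \<open>Order of the one-step error\<close>

abbreviation pw :: "nat \<Rightarrow> real \<Rightarrow> complex" where "pw n \<equiv> \<lambda>h. complex_of_real h ^ n"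

lemma bigo_pw_mult:
  assumes "f \<in> O[F](pw m)" "g \<in> O[F](pw n)"
  shows "(\<lambda>h. f h * g h) \<in> O[F](pw (m + n))"
  using landau_o.big.mult[OF assms] by (simp add: power_add)

lemma bigo_pw_mono:
  assumes "f \<in> O[at_right 0](pw n)" "m \<le> n"
  shows "f \<in> O[at_right 0](pw m)"
proof -
  have "eventually (\<lambda>h::real. 0 < h \<and> h < 1) (at_right 0)"
    by (rule eventually_at_right_real[of 0 1, simplified greaterThanLessThan_iff]) simp
  then have "pw n \<in> O[at_right 0](pw m)"
    by (intro bigoI[of _ 1], elim eventually_mono) (auto simp: norm_power intro: power_decreasing assms(2))
  then show ?thesis using assms(1) landau_o.big_trans by blast
qed

lemma pw_bigo: "(\<lambda>h. c * complex_of_real h ^ n) \<in> O[at_right 0](pw n)"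
  by (rule bigoI[of _ "norm c"]) (simp add: norm_mult)

lemma exp_remainder_bigo:
  "(\<lambda>h. exp (of_real (c * h) * \<mu>) - (\<Sum>k\<le>n. (of_real (c * h) * \<mu>) ^ k / fact k)) \<in> O[at_right 0](pw (Suc n))"
proof (rule bigoI)
  have "eventually (\<lambda>h::real. 0 < h \<and> h < 1) (at_right 0)"
    by (rule eventually_at_right_real[of 0 1, simplified greaterThanLessThan_iff]) simp
  then show "eventually (\<lambda>h. norm (exp (of_real (c * h) * \<mu>) - (\<Sum>k\<le>n. (of_real (c * h) * \<mu>) ^ k / fact k))
      \<le> (exp (\<bar>c\<bar> * norm \<mu>) * (\<bar>c\<bar> * norm \<mu>) ^ Suc n / fact n) * norm (pw (Suc n) h)) (at_right 0)"
  proof eventually_elim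
    case (elim h)
    let ?z = "of_real (c * h) * \<mu>"
    have nz: "norm ?z = h * (\<bar>c\<bar> * norm \<mu>)" using elim by (simp add: norm_mult abs_mult)
    have "\<bar>Re ?z\<bar> \<le> norm ?z" by (rule abs_Re_le_cmod)
    also have "\<dots> \<le> \<bar>c\<bar> * norm \<mu>" unfolding nz using elim by (intro mult_left_le_one_le) auto
    finally have "exp \<bar>Re ?z\<bar> \<le> exp (\<bar>c\<bar> * norm \<mu>)" by simp
    then have "exp \<bar>Re ?z\<bar> * norm ?z ^ Suc n / fact n \<le> exp (\<bar>c\<bar> * norm \<mu>) * norm ?z ^ Suc n / fact n"
      by (intro divide_right_mono mult_right_mono) auto
    also have "\<dots> = (exp (\<bar>c\<bar> * norm \<mu>) * (\<bar>c\<bar> * norm \<mu>) ^ Suc n / fact n) * norm (pw (Suc n) h)"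
      unfolding nz power_mult_distrib norm_power using elim by simp
    finally show ?case using Taylor_exp[of ?z n] by linarith
  qed
qed

text \<open>What remains when the exact solution \<open>exp (\<mu> t)\<close> of \<open>w' = \<mu> w\<close> is inserted into the formula of stage \<open>i\<close>.\<close>
definition defect :: "(nat \<Rightarrow> nat \<Rightarrow> real) \<Rightarrow> (nat \<Rightarrow> real) \<Rightarrow> complex \<Rightarrow> nat \<Rightarrow> real \<Rightarrow> complex" where
  "defect \<alpha> \<gamma> \<mu> i h = exp (of_real (\<gamma> i * h) * \<mu>) - 1
     - of_real h * \<mu> * (\<Sum>j=0..i. of_real (\<alpha> i j) * exp (of_real (\<gamma> j * h) * \<mu>))"

text \<open>The residual of the order condition that row \<open>i\<close>, used as a quadrature rule on \<open>[0, \<gamma> i]\<close>, integrates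
  \<open>t ^ k\<close> exactly, divided by \<open>k!\<close>. For \<open>k = 0\<close> and the node \<open>0\<close> the power \<open>0 ^ 0 = 1\<close> is the intended one.\<close>
definition row_residual :: "(nat \<Rightarrow> nat \<Rightarrow> real) \<Rightarrow> (nat \<Rightarrow> real) \<Rightarrow> nat \<Rightarrow> nat \<Rightarrow> real" where
  "row_residual \<alpha> \<gamma> i k = \<gamma> i ^ Suc k / fact (Suc k) - (\<Sum>j=0..i. \<alpha> i j * \<gamma> j ^ k) / fact k"

lemma defect_expansion:
  "(\<lambda>h. defect \<alpha> \<gamma> \<mu> i h - (\<Sum>k\<le>m. of_real (row_residual \<alpha> \<gamma> i k) * (of_real h * \<mu>) ^ Suc k))
     \<in> O[at_right 0](pw (Suc (Suc m)))"
proof -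
  define rem where "rem = (\<lambda>n c h. exp (of_real (c * h) * \<mu>) - (\<Sum>k\<le>n. (of_real (c * h) * \<mu>) ^ k / fact k))"
  have e: "exp (of_real (c * h) * \<mu>) = rem n c h + (\<Sum>k\<le>n. (of_real (c * h) * \<mu>) ^ k / fact k)" for n c h
    by (simp add: rem_def)
  have "defect \<alpha> \<gamma> \<mu> i h - (\<Sum>k\<le>m. of_real (row_residual \<alpha> \<gamma> i k) * (of_real h * \<mu>) ^ Suc k)
    = rem (Suc m) (\<gamma> i) h - (\<mu> * of_real h) * (\<Sum>j=0..i. of_real (\<alpha> i j) * rem m (\<gamma> j) h)" for h
  proof -
    let ?z = "of_real h * \<mu>"
    have t: "(of_real (c * h) * \<mu>) ^ k / fact k = of_real (c ^ k / fact k) * ?z ^ k" for c k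
      by (simp add: power_mult_distrib)
    have 1: "(\<Sum>k\<le>Suc m. (of_real (\<gamma> i * h) * \<mu>) ^ k / fact k) =
        1 + (\<Sum>k\<le>m. of_real (\<gamma> i ^ Suc k / fact (Suc k)) * ?z ^ Suc k)"
      unfolding t by (subst sum.atMost_Suc_shift) simp
    have "?z * (\<Sum>j=0..i. of_real (\<alpha> i j) * (\<Sum>k\<le>m. (of_real (\<gamma> j * h) * \<mu>) ^ k / fact k)) =
      (\<Sum>j=0..i. \<Sum>k\<le>m. of_real (\<alpha> i j * \<gamma> j ^ k / fact k) * ?z ^ Suc k)"
      unfolding t sum_distrib_left by (intro sum.cong refl) simp
    also have "\<dots> = (\<Sum>k\<le>m. of_real ((\<Sum>j=0..i. \<alpha> i j * \<gamma> j ^ k) / fact k) * ?z ^ Suc k)"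
      by (subst sum.swap) (simp add: sum_distrib_right sum_divide_distrib)
    finally have 2: "?z * (\<Sum>j=0..i. of_real (\<alpha> i j) * (\<Sum>k\<le>m. (of_real (\<gamma> j * h) * \<mu>) ^ k / fact k)) = \<dots>" .
    have 3: "(\<Sum>k\<le>m. of_real (row_residual \<alpha> \<gamma> i k) * ?z ^ Suc k) =
      (\<Sum>k\<le>m. of_real (\<gamma> i ^ Suc k / fact (Suc k)) * ?z ^ Suc k) -
      (\<Sum>k\<le>m. of_real ((\<Sum>j=0..i. \<alpha> i j * \<gamma> j ^ k) / fact k) * ?z ^ Suc k)"
      unfolding sum_subtractf[symmetric] row_residual_def of_real_diff left_diff_distrib ..
    have 4: "?z * (\<Sum>j=0..i. of_real (\<alpha> i j) * exp (of_real (\<gamma> j * h) * \<mu>)) =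
       ?z * (\<Sum>j=0..i. of_real (\<alpha> i j) * rem m (\<gamma> j) h) +
       (\<Sum>k\<le>m. of_real ((\<Sum>j=0..i. \<alpha> i j * \<gamma> j ^ k) / fact k) * ?z ^ Suc k)"
      unfolding 2[symmetric] e[where n = m] distrib_left sum.distrib ..
    show ?thesis
      unfolding defect_def 3 4 e[of "\<gamma> i" h "Suc m"] 1 by (simp add: algebra_simps)
  qed
  then have eq: "(\<lambda>h. defect \<alpha> \<gamma> \<mu> i h - (\<Sum>k\<le>m. of_real (row_residual \<alpha> \<gamma> i k) * (of_real h * \<mu>) ^ Suc k))
    = (\<lambda>h. rem (Suc m) (\<gamma> i) h - (\<mu> * of_real h ^ 1) * (\<Sum>j=0..i. of_real (\<alpha> i j) * rem m (\<gamma> j) h))"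
    by simp
  have r: "rem n c \<in> O[at_right 0](pw (Suc n))" for n c
    unfolding rem_def by (rule exp_remainder_bigo)
  have "(\<lambda>h. \<Sum>j=0..i. of_real (\<alpha> i j) * rem m (\<gamma> j) h) \<in> O[at_right 0](pw (Suc m))"
    by (intro big_sum_in_bigo) (use r in \<open>simp add: landau_o.big.cmult_in_iff'\<close>)
  from bigo_pw_mult[OF pw_bigo this, of \<mu> 1] r[of "Suc m" "\<gamma> i"]
  show ?thesis unfolding eq by (intro sum_in_bigo) simp_all
qed

text \<open>The factor in front of the stage value tends to one, so solving for the stage does not change the order.\<close>
lemma bigo_stage_solve:
  assumes "(\<lambda>h. (1 - of_real a * (of_real h * \<mu>)) * e h) \<in> O[at_right 0](pw n)"
  shows "e \<in> O[at_right 0](pw n)"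
proof -
  have lim: "((\<lambda>h. 1 - of_real a * (complex_of_real h * \<mu>)) \<longlongrightarrow> 1) (at_right 0)"
    by (auto intro!: tendsto_eq_intros)
  have ev: "eventually (\<lambda>h. 1 - of_real a * (complex_of_real h * \<mu>) \<noteq> 0) (at_right 0)"
    using tendsto_imp_eventually_ne[OF lim, of 0] by simp
  have "((\<lambda>h. inverse (1 - of_real a * (complex_of_real h * \<mu>))) \<longlongrightarrow> 1) (at_right 0)"
    using tendsto_inverse[OF lim] by simp
  then have "(\<lambda>h. inverse (1 - of_real a * (complex_of_real h * \<mu>))) \<in> O[at_right 0](pw 0)"
    by (intro bigoI_tendsto[of _ _ 1]) auto
  from bigo_pw_mult[OF this assms]
  have "(\<lambda>h. inverse (1 - of_real a * (complex_of_real h * \<mu>)) * ((1 - of_real a * (of_real h * \<mu>)) * e h))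
     \<in> O[at_right 0](pw n)" by simp
  also have "?this \<longleftrightarrow> ?thesis"
    using ev by (intro landau_o.big.in_cong) (elim eventually_mono, simp add: mult.assoc[symmetric])
  finally show ?thesis .
qed

text \<open>The numerical solution is compared with \<open>E\<close>, the solution \<open>A exp t + B exp (\<mu> t)\<close> for the load
  \<open>(1 - \<mu>) A exp t\<close>; suitable \<open>A\<close> and \<open>B\<close> give the homogeneous problem as well as the loaded one with
  zero data. The stage errors \<open>e\<close> satisfy the recursion of the method with the defects as source. Stage order two
  gives \<open>e i = O(h\<^sup>3)\<close> with leading term the residual of row \<open>i\<close>; these leading terms enter the last stage with an
  additional factor \<open>h\<close>, and the hypothesis \<open>coupling\<close> cancels them.\<close>
lemma step_error_bigo:
  fixes \<alpha> :: "nat \<Rightarrow> nat \<Rightarrow> real" and \<gamma> :: "nat \<Rightarrow> real" and A B \<mu> :: complex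
  defines "E \<equiv> \<lambda>i h. A * exp (of_real (\<gamma> i * h)) + B * exp (of_real (\<gamma> i * h) * \<mu>)"
    and "S \<equiv> \<lambda>i h. stage \<alpha> (of_real h * \<mu>) (\<lambda>j. of_real h * ((1 - \<mu>) * A * exp (of_real (\<gamma> j * h)))) (A + B) i"
  assumes g0: "\<gamma> 0 = 0"
    and stage_order: "\<And>i. i \<in> {1..s} \<Longrightarrow> row_residual \<alpha> \<gamma> i 0 = 0 \<and> row_residual \<alpha> \<gamma> i 1 = 0"
    and quad: "row_residual \<alpha> \<gamma> s 2 = 0" "row_residual \<alpha> \<gamma> s 3 = 0"
    and coupling: "(\<Sum>j\<in>{1..<s}. \<alpha> s j * row_residual \<alpha> \<gamma> j 2) = 0"
    and s: "s \<ge> 1"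
  shows "(\<lambda>h. E s h - S s h) \<in> O[at_right 0](pw 5)"
proof -
  define e where "e = (\<lambda>i h. E i h - S i h)"
  define \<delta> where "\<delta> = (\<lambda>i h. A * defect \<alpha> \<gamma> 1 i h + B * defect \<alpha> \<gamma> \<mu> i h)"
  have e0: "e 0 h = 0" for h by (simp add: e_def E_def S_def g0)
  have rec: "eventually (\<lambda>h. (1 - of_real (\<alpha> i i) * (of_real h * \<mu>)) * e i h =
      of_real h * \<mu> * (\<Sum>j<i. of_real (\<alpha> i j) * e j h) + \<delta> i h) (at_right 0)" if i: "i \<ge> 1" for i
  proof -
    have lim: "((\<lambda>h. 1 - of_real (\<alpha> i i) * (complex_of_real h * \<mu>)) \<longlongrightarrow> 1) (at_right 0)"
      by (auto intro!: tendsto_eq_intros)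
    have ev: "eventually (\<lambda>h. 1 - of_real (\<alpha> i i) * (complex_of_real h * \<mu>) \<noteq> 0) (at_right 0)"
      using tendsto_imp_eventually_ne[OF lim, of 0] by simp
    then show ?thesis
    proof eventually_elim
      case (elim h)
      let ?z = "of_real h * \<mu>" and ?a = "\<lambda>j. complex_of_real (\<alpha> i j)"
      define g where "g = (\<lambda>j. complex_of_real h * ((1 - \<mu>) * A * exp (of_real (\<gamma> j * h))))"
      have S: "(1 - ?a i * ?z) * S i h = A + B + (\<Sum>j<i. ?a j * (?z * S j h + g j)) + ?a i * g i"
        using elim i unfolding S_def g_def[symmetric] by (subst stage.simps) simp
      have dec: "\<delta> i h = E i h - (A + B) - (\<Sum>j=0..i. ?a j * (?z * E j h + g j))"
      proof -
        have "(\<Sum>j=0..i. ?a j * (?z * E j h + g j)) =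
          (\<Sum>j=0..i. A * (of_real h * (?a j * exp (of_real (\<gamma> j * h)))) + B * (?z * (?a j * exp (of_real (\<gamma> j * h) * \<mu>))))"
          by (rule sum.cong) (simp_all add: E_def g_def algebra_simps)
        also have "\<dots> = A * (of_real h * (\<Sum>j=0..i. ?a j * exp (of_real (\<gamma> j * h)))) +
            B * (?z * (\<Sum>j=0..i. ?a j * exp (of_real (\<gamma> j * h) * \<mu>)))"
          by (simp only: sum.distrib sum_distrib_left)
        finally have eq: "(\<Sum>j=0..i. ?a j * (?z * E j h + g j)) = \<dots>" .
        show ?thesis unfolding eq by (simp add: \<delta>_def defect_def E_def algebra_simps)
      qed
      have "{0..i} = insert i {..<i}" by auto
      then have sp: "(\<Sum>j=0..i. ?a j * (?z * E j h + g j)) =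
          ?a i * (?z * E i h + g i) + (\<Sum>j<i. ?a j * (?z * E j h + g j))" by simp
      have df: "(\<Sum>j<i. ?a j * (?z * E j h + g j)) - (\<Sum>j<i. ?a j * (?z * S j h + g j))
          = ?z * (\<Sum>j<i. ?a j * e j h)"
        unfolding sum_subtractf[symmetric] sum_distrib_left
        by (rule sum.cong) (simp_all add: e_def algebra_simps)
      have "(1 - ?a i * ?z) * e i h = (1 - ?a i * ?z) * E i h - (1 - ?a i * ?z) * S i h"
        by (simp add: e_def algebra_simps)
      also have "\<dots> = ((\<Sum>j<i. ?a j * (?z * E j h + g j)) - (\<Sum>j<i. ?a j * (?z * S j h + g j))) + \<delta> i h"
        unfolding S dec sp by (simp add: algebra_simps)
      finally show ?case unfolding df .
    qed
  qed
  have \<delta>_exp: "(\<lambda>h. \<delta> i h - (\<Sum>k\<le>m. of_real (row_residual \<alpha> \<gamma> i k) * (A + B * \<mu> ^ Suc k) * of_real h ^ Suc k))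
      \<in> O[at_right 0](pw (Suc (Suc m)))" for i m
  proof -
    let ?D = "\<lambda>\<mu> h. defect \<alpha> \<gamma> \<mu> i h - (\<Sum>k\<le>m. of_real (row_residual \<alpha> \<gamma> i k) * (of_real h * \<mu>) ^ Suc k)"
    have "(\<lambda>h. A * ?D 1 h + B * ?D \<mu> h) \<in> O[at_right 0](pw (Suc (Suc m)))"
      by (intro sum_in_bigo landau_o.big.mult_in_1 bigo_pw_mult[where m = 0, simplified] defect_expansion) simp_all
    also have "(\<lambda>h. A * ?D 1 h + B * ?D \<mu> h) = (\<lambda>h. \<delta> i h -
       (\<Sum>k\<le>m. of_real (row_residual \<alpha> \<gamma> i k) * (A + B * \<mu> ^ Suc k) * of_real h ^ Suc k))"
    proof
      fix h
      have "(\<Sum>k\<le>m. of_real (row_residual \<alpha> \<gamma> i k) * (A + B * \<mu> ^ Suc k) * of_real h ^ Suc k) =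
        A * (\<Sum>k\<le>m. of_real (row_residual \<alpha> \<gamma> i k) * (of_real h * 1) ^ Suc k) +
        B * (\<Sum>k\<le>m. of_real (row_residual \<alpha> \<gamma> i k) * (of_real h * \<mu>) ^ Suc k)"
        unfolding sum_distrib_left sum.distrib[symmetric] power_mult_distrib
        by (rule sum.cong) (simp_all add: ring_distribs mult_ac)
      then show "A * ?D 1 h + B * ?D \<mu> h = \<delta> i h -
         (\<Sum>k\<le>m. of_real (row_residual \<alpha> \<gamma> i k) * (A + B * \<mu> ^ Suc k) * of_real h ^ Suc k)"
        unfolding \<delta>_def right_diff_distrib by simp
    qed
    finally show ?thesis .
  qed
  have \<delta>3: "\<delta> i \<in> O[at_right 0](pw 3)" and
    \<delta>4: "(\<lambda>h. \<delta> i h - of_real (row_residual \<alpha> \<gamma> i 2) * (A + B * \<mu> ^ 3) * of_real h ^ 3) \<in> O[at_right 0](pw 4)"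
    if i: "i \<in> {1..s}" for i
    using \<delta>_exp[of i 1] \<delta>_exp[of i 2] stage_order[OF i] by (simp_all add: numeral_eq_Suc)
  have \<delta>5: "\<delta> s \<in> O[at_right 0](pw 5)"
    using \<delta>_exp[of s 3] stage_order[of s] quad s by (simp add: numeral_eq_Suc)
  have e3: "e i \<in> O[at_right 0](pw 3)" if "i \<le> s" for i
    using that
  proof (induction i rule: less_induct)
    case (less i)
    show ?case
    proof (cases "i = 0")
      case True
      then show ?thesis by (simp add: e0[abs_def])
    next
      case False
      have "(\<lambda>h. \<Sum>j<i. of_real (\<alpha> i j) * e j h) \<in> O[at_right 0](pw 3)"
        using less by (intro big_sum_in_bigo bigo_pw_mult[where m = 0, simplified]) auto
      from bigo_pw_mult[OF pw_bigo[of \<mu> 1] this]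
      have "(\<lambda>h. of_real h * \<mu> * (\<Sum>j<i. of_real (\<alpha> i j) * e j h)) \<in> O[at_right 0](pw 4)"
        by (simp add: mult_ac)
      then have "(\<lambda>h. of_real h * \<mu> * (\<Sum>j<i. of_real (\<alpha> i j) * e j h) + \<delta> i h) \<in> O[at_right 0](pw 3)"
        using \<delta>3[of i] False less.prems by (intro sum_in_bigo(1)[OF bigo_pw_mono[of _ 4 3]]) auto
      then have "(\<lambda>h. (1 - of_real (\<alpha> i i) * (of_real h * \<mu>)) * e i h) \<in> O[at_right 0](pw 3)"
        using landau_o.big.in_cong[OF rec[of i]] False by simp
      then show ?thesis by (rule bigo_stage_solve)
    qed
  qed
  have e4: "(\<lambda>h. e i h - of_real (row_residual \<alpha> \<gamma> i 2) * (A + B * \<mu> ^ 3) * of_real h ^ 3) \<in> O[at_right 0](pw 4)"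
    if i: "i \<in> {1..s}" for i
  proof -
    have "(\<lambda>h. \<Sum>j\<le>i. of_real (\<alpha> i j) * e j h) \<in> O[at_right 0](pw 3)"
      using i e3 by (intro big_sum_in_bigo bigo_pw_mult[where m = 0, simplified]) auto
    from bigo_pw_mult[OF pw_bigo[of \<mu> 1] this]
    have "(\<lambda>h. of_real h * \<mu> * (\<Sum>j\<le>i. of_real (\<alpha> i j) * e j h)) \<in> O[at_right 0](pw 4)"
      by (simp add: mult_ac)
    from sum_in_bigo(1)[OF this \<delta>4[OF i]]
    have "(\<lambda>h. of_real h * \<mu> * (\<Sum>j\<le>i. of_real (\<alpha> i j) * e j h) +
       (\<delta> i h - of_real (row_residual \<alpha> \<gamma> i 2) * (A + B * \<mu> ^ 3) * of_real h ^ 3)) \<in> O[at_right 0](pw 4)" .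
    also have "?this \<longleftrightarrow> ?thesis"
    proof (rule landau_o.big.in_cong)
      have "{..i} = insert i {..<i}" by auto
      then have sp: "(\<Sum>j\<le>i. of_real (\<alpha> i j) * e j h) = of_real (\<alpha> i i) * e i h + (\<Sum>j<i. of_real (\<alpha> i j) * e j h)"
        for h by simp
      have "i \<ge> 1" using i by simp
      from rec[OF this]
      show "eventually (\<lambda>h. of_real h * \<mu> * (\<Sum>j\<le>i. of_real (\<alpha> i j) * e j h) +
         (\<delta> i h - of_real (row_residual \<alpha> \<gamma> i 2) * (A + B * \<mu> ^ 3) * of_real h ^ 3) =
         e i h - of_real (row_residual \<alpha> \<gamma> i 2) * (A + B * \<mu> ^ 3) * of_real h ^ 3) (at_right 0)"
      proof eventually_elim
        case (elim h)
        then show ?case unfolding sp by (simp add: algebra_simps)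
      qed
    qed
    finally show ?thesis .
  qed
  have "(\<lambda>h. \<Sum>j\<in>{1..<s}. of_real (\<alpha> s j) *
      (e j h - of_real (row_residual \<alpha> \<gamma> j 2) * (A + B * \<mu> ^ 3) * of_real h ^ 3)) \<in> O[at_right 0](pw 4)"
    using e4 by (intro big_sum_in_bigo bigo_pw_mult[where m = 0, simplified]) auto
  also have "(\<lambda>h. \<Sum>j\<in>{1..<s}. of_real (\<alpha> s j) *
      (e j h - of_real (row_residual \<alpha> \<gamma> j 2) * (A + B * \<mu> ^ 3) * of_real h ^ 3)) =
      (\<lambda>h. \<Sum>j<s. of_real (\<alpha> s j) * e j h)"
  proof
    fix h
    \<comment> \<open>The leading terms add up to zero by \<open>coupling\<close>, and the error at node \<open>0\<close> vanishes.\<close>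
    have sp: "{..<s} = insert 0 {1..<s}" using s by auto
    have "(\<Sum>j\<in>{1..<s}. of_real (\<alpha> s j) *
      (e j h - of_real (row_residual \<alpha> \<gamma> j 2) * (A + B * \<mu> ^ 3) * of_real h ^ 3)) =
      (\<Sum>j\<in>{1..<s}. of_real (\<alpha> s j) * e j h) -
      of_real (\<Sum>j\<in>{1..<s}. \<alpha> s j * row_residual \<alpha> \<gamma> j 2) * ((A + B * \<mu> ^ 3) * of_real h ^ 3)"
      unfolding of_real_sum sum_distrib_right sum_subtractf[symmetric]
      by (rule sum.cong) (simp_all add: algebra_simps)
    then show "(\<Sum>j\<in>{1..<s}. of_real (\<alpha> s j) *
      (e j h - of_real (row_residual \<alpha> \<gamma> j 2) * (A + B * \<mu> ^ 3) * of_real h ^ 3)) =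
       (\<Sum>j<s. of_real (\<alpha> s j) * e j h)" unfolding coupling sp by (simp add: e0)
  qed
  finally have "(\<lambda>h. \<Sum>j<s. of_real (\<alpha> s j) * e j h) \<in> O[at_right 0](pw 4)" .
  from bigo_pw_mult[OF pw_bigo[of \<mu> 1] this]
  have "(\<lambda>h. of_real h * \<mu> * (\<Sum>j<s. of_real (\<alpha> s j) * e j h)) \<in> O[at_right 0](pw 5)"
    by (simp add: mult_ac)
  from sum_in_bigo(1)[OF this \<delta>5]
  have "(\<lambda>h. (1 - of_real (\<alpha> s s) * (of_real h * \<mu>)) * e s h) \<in> O[at_right 0](pw 5)"
    using landau_o.big.in_cong[OF rec[OF s]] by simp
  then have "e s \<in> O[at_right 0](pw 5)" by (rule bigo_stage_solve)
  then show ?thesis by (simp add: e_def)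
qed

section \<open>Fourth order accuracy of the SUCI4 parameters\<close>

text \<open>The parameters as solutions of the order conditions, with \<open>c\<close> the common diagonal entry. After the row sums come
  stage order two for the rows 2, 3 and 4, the quadrature conditions of the last row for \<open>t\<^sup>2\<close> and \<open>t\<^sup>3\<close> (where
  \<open>c\<close> on the right is the contribution of the last node, which is \<open>1\<close>), and the condition that fixes \<open>\<alpha> 3 2\<close>.\<close>
lemma suci4_conditions:
  assumes "suci4_params \<alpha> \<gamma>"
  defines "c \<equiv> \<gamma> 1 / 2"
  shows "\<gamma> 0 = 0" "\<gamma> 4 = 1" "\<gamma> 1 = 2 * c" "c > 0"
    and "\<alpha> 1 0 = c" "\<alpha> 1 1 = c" "\<alpha> 2 2 = c" "\<alpha> 3 3 = c" "\<alpha> 4 4 = c"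
    and "\<alpha> 2 0 = \<gamma> 2 - c - \<alpha> 2 1"
    and "\<alpha> 3 0 = \<gamma> 3 - c - \<alpha> 3 1 - \<alpha> 3 2"
    and "\<alpha> 4 0 = 1 - c - \<alpha> 4 1 - \<alpha> 4 2 - \<alpha> 4 3"
    and "2 * c * \<alpha> 2 1 = (\<gamma> 2)\<^sup>2 / 2 - c * \<gamma> 2"
    and "2 * c * \<alpha> 3 1 = (\<gamma> 3)\<^sup>2 / 2 - c * \<gamma> 3 - \<gamma> 2 * \<alpha> 3 2"
    and "2 * c * \<alpha> 4 1 = 1 / 2 - c - \<gamma> 2 * \<alpha> 4 2 - \<gamma> 3 * \<alpha> 4 3"
    and "4 * c\<^sup>2 * \<alpha> 4 1 + (\<gamma> 2)\<^sup>2 * \<alpha> 4 2 + (\<gamma> 3)\<^sup>2 * \<alpha> 4 3 = 1 / 3 - c"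
    and "8 * c ^ 3 * \<alpha> 4 1 + (\<gamma> 2) ^ 3 * \<alpha> 4 2 + (\<gamma> 3) ^ 3 * \<alpha> 4 3 = 1 / 4 - c"
    and "\<alpha> 4 3 * \<alpha> 3 2 * \<gamma> 2 * (\<gamma> 2 - 2 * c) = (- 24 * c ^ 3 + 36 * c\<^sup>2 - 12 * c + 1) / 12"
proof -
  note p = assms(1)[unfolded suci4_params_def]
  have g1: "\<gamma> 1 = 2 * c" by (simp add: c_def)
  have c0: "c > 0" using p by (simp add: c_def)
  show "\<gamma> 0 = 0" "\<gamma> 4 = 1" "\<gamma> 1 = 2 * c" "c > 0"
    "\<alpha> 1 0 = c" "\<alpha> 1 1 = c" "\<alpha> 2 2 = c" "\<alpha> 3 3 = c" "\<alpha> 4 4 = c"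
    using p g1 c0 by (simp_all add: c_def)
  have nz: "12 * \<gamma> 3 * (\<gamma> 3 - \<gamma> 2) * (\<gamma> 3 - \<gamma> 1) \<noteq> 0" "6 * \<gamma> 2 * (\<gamma> 2 - \<gamma> 1) \<noteq> 0"
     "12 * \<alpha> 4 3 * \<gamma> 2 * (\<gamma> 2 - \<gamma> 1) \<noteq> 0" "2 * \<gamma> 1 \<noteq> 0" using p by auto
  have a43: "\<alpha> 4 3 * (12 * \<gamma> 3 * (\<gamma> 3 - \<gamma> 2) * (\<gamma> 3 - 2 * c)) =
      6 * (1 - \<gamma> 2) * (2 * c)\<^sup>2 + 12 * (2 * c) * \<gamma> 2 - 10 * (2 * c) - 4 * \<gamma> 2 + 3"
    unfolding g1[symmetric] nonzero_eq_divide_eq[OF nz(1), symmetric] using p by blast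
  have a42: "\<alpha> 4 2 * (6 * \<gamma> 2 * (\<gamma> 2 - 2 * c)) =
      6 * \<alpha> 4 3 * (2 * c) * \<gamma> 3 - 6 * \<alpha> 4 3 * (\<gamma> 3)\<^sup>2 + 3 * (2 * c)\<^sup>2 - 6 * (2 * c) + 2"
    unfolding g1[symmetric] nonzero_eq_divide_eq[OF nz(2), symmetric] using p by blast
  have a32: "\<alpha> 3 2 * (12 * \<alpha> 4 3 * \<gamma> 2 * (\<gamma> 2 - 2 * c)) = - 3 * (2 * c) ^ 3 + 9 * (2 * c)\<^sup>2 - 6 * (2 * c) + 1"
    unfolding g1[symmetric] nonzero_eq_divide_eq[OF nz(3), symmetric] using p by blast
  have a20: "\<alpha> 2 0 * (2 * (2 * c)) = - (2 * c)\<^sup>2 + 3 * (2 * c) * \<gamma> 2 - (\<gamma> 2)\<^sup>2"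
    and a21: "\<alpha> 2 1 * (2 * (2 * c)) = \<gamma> 2 * (\<gamma> 2 - 2 * c)"
    and a30: "\<alpha> 3 0 * (2 * (2 * c)) = - (2 * c)\<^sup>2 + (3 * \<gamma> 3 - 2 * \<alpha> 3 2) * (2 * c) + 2 * \<alpha> 3 2 * \<gamma> 2 - (\<gamma> 3)\<^sup>2"
    and a31: "\<alpha> 3 1 * (2 * (2 * c)) = - 2 * \<alpha> 3 2 * \<gamma> 2 - 2 * c * \<gamma> 3 + (\<gamma> 3)\<^sup>2"
    and a40: "\<alpha> 4 0 * (2 * (2 * c)) = - (2 * c)\<^sup>2 + (3 - 2 * \<alpha> 4 2 - 2 * \<alpha> 4 3) * (2 * c) + 2 * \<alpha> 4 2 * \<gamma> 2
                + 2 * \<alpha> 4 3 * \<gamma> 3 - 1"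
    and a41: "\<alpha> 4 1 * (2 * (2 * c)) = - 2 * \<alpha> 4 2 * \<gamma> 2 - 2 * \<alpha> 4 3 * \<gamma> 3 - 2 * c + 1"
    unfolding g1[symmetric] nonzero_eq_divide_eq[OF nz(4), symmetric] using p by blast+
  have "c * \<alpha> 2 0 = c * (\<gamma> 2 - c - \<alpha> 2 1)" using a20 a21 by (simp add: algebra_simps power2_eq_square)
  then show "\<alpha> 2 0 = \<gamma> 2 - c - \<alpha> 2 1" using c0 by simp
  have "c * \<alpha> 3 0 = c * (\<gamma> 3 - c - \<alpha> 3 1 - \<alpha> 3 2)" using a30 a31 by (simp add: algebra_simps power2_eq_square)
  then show "\<alpha> 3 0 = \<gamma> 3 - c - \<alpha> 3 1 - \<alpha> 3 2" using c0 by simp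
  have "c * \<alpha> 4 0 = c * (1 - c - \<alpha> 4 1 - \<alpha> 4 2 - \<alpha> 4 3)" using a40 a41 by (simp add: algebra_simps power2_eq_square)
  then show "\<alpha> 4 0 = 1 - c - \<alpha> 4 1 - \<alpha> 4 2 - \<alpha> 4 3" using c0 by simp
  show "2 * c * \<alpha> 2 1 = (\<gamma> 2)\<^sup>2 / 2 - c * \<gamma> 2" using a21 by (simp add: algebra_simps power2_eq_square)
  show "2 * c * \<alpha> 3 1 = (\<gamma> 3)\<^sup>2 / 2 - c * \<gamma> 3 - \<gamma> 2 * \<alpha> 3 2" using a31 by (simp add: algebra_simps power2_eq_square)
  show q1: "2 * c * \<alpha> 4 1 = 1 / 2 - c - \<gamma> 2 * \<alpha> 4 2 - \<gamma> 3 * \<alpha> 4 3" using a41 by (simp add: algebra_simps)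
  have "4 * c\<^sup>2 * \<alpha> 4 1 = 2 * c * (1 / 2 - c - \<gamma> 2 * \<alpha> 4 2 - \<gamma> 3 * \<alpha> 4 3)"
    unfolding q1[symmetric] by (simp add: power2_eq_square)
  then show q2: "4 * c\<^sup>2 * \<alpha> 4 1 + (\<gamma> 2)\<^sup>2 * \<alpha> 4 2 + (\<gamma> 3)\<^sup>2 * \<alpha> 4 3 = 1 / 3 - c"
    using a42 by (simp add: algebra_simps power2_eq_square)
  have x: "\<gamma> 2 * (\<alpha> 4 2 * (\<gamma> 2 * (\<gamma> 2 - 2 * c))) = \<gamma> 2 * ((6 * \<alpha> 4 3 * (2 * c) * \<gamma> 3 - 6 * \<alpha> 4 3 * (\<gamma> 3)\<^sup>2 + 3 * (2 * c)\<^sup>2 - 6 * (2 * c) + 2) / 6)"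
    by (rule arg_cong[of _ _ "(*) (\<gamma> 2)"]) (use a42 in simp)
  have t: "4 * c\<^sup>2 * \<alpha> 4 1 = 1 / 3 - c - (\<gamma> 2)\<^sup>2 * \<alpha> 4 2 - (\<gamma> 3)\<^sup>2 * \<alpha> 4 3" using q2 by simp
  have "8 * c ^ 3 * \<alpha> 4 1 = 2 * c * (1 / 3 - c - (\<gamma> 2)\<^sup>2 * \<alpha> 4 2 - (\<gamma> 3)\<^sup>2 * \<alpha> 4 3)"
    unfolding t[symmetric] by (simp add: power3_eq_cube power2_eq_square)
  then show "8 * c ^ 3 * \<alpha> 4 1 + (\<gamma> 2) ^ 3 * \<alpha> 4 2 + (\<gamma> 3) ^ 3 * \<alpha> 4 3 = 1 / 4 - c"
    using x a43 by (simp add: power3_eq_cube power2_eq_square algebra_simps)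
  show "\<alpha> 4 3 * \<alpha> 3 2 * \<gamma> 2 * (\<gamma> 2 - 2 * c) = (- 24 * c ^ 3 + 36 * c\<^sup>2 - 12 * c + 1) / 12"
    using a32 by (simp add: power3_eq_cube power2_eq_square algebra_simps)
qed

lemma row_sum_expand:
  "(\<Sum>j=0..1. f j) = f 0 + f 1" "(\<Sum>j=0..2. f j) = f 0 + f 1 + f 2" "(\<Sum>j=0..3. f j) = f 0 + f 1 + f 2 + f 3"
  "(\<Sum>j=0..4. f j) = f 0 + f 1 + f 2 + f 3 + f 4" for f :: "nat \<Rightarrow> 'a :: comm_monoid_add"
  by (simp_all add: eval_nat_numeral add.assoc)

text \<open>Only the last statement is not immediate. As all rows have stage order two, it says that \<open>b A \<gamma>\<^sup>2 = 1 / 12\<close> for the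
  last row \<open>b\<close>, given the cubic quadrature condition; the condition on \<open>\<alpha> 3 2\<close> is this equation.\<close>
lemma suci4_order_conditions:
  assumes sp: "suci4_params \<alpha> \<gamma>"
  shows "i \<in> {1..4} \<Longrightarrow> row_residual \<alpha> \<gamma> i 0 = 0 \<and> row_residual \<alpha> \<gamma> i 1 = 0"
    and "row_residual \<alpha> \<gamma> 4 2 = 0" "row_residual \<alpha> \<gamma> 4 3 = 0"
    and "(\<Sum>j\<in>{1..<4}. \<alpha> 4 j * row_residual \<alpha> \<gamma> j 2) = 0"
proof -
  define c where "c = \<gamma> 1 / 2"
  note k = suci4_conditions[OF sp, folded c_def]
  have k1: "\<alpha> (Suc 0) 0 = c" "\<alpha> (Suc 0) (Suc 0) = c" "\<gamma> (Suc 0) = 2 * c" using k(3,5,6) by simp_all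
  have r0: "row_residual \<alpha> \<gamma> 1 0 = 0" "row_residual \<alpha> \<gamma> 2 0 = 0" "row_residual \<alpha> \<gamma> 3 0 = 0" "row_residual \<alpha> \<gamma> 4 0 = 0"
    unfolding row_residual_def row_sum_expand by (simp_all add: k(1,2,7-12) k1)
  have r1: "row_residual \<alpha> \<gamma> 1 1 = 0" "row_residual \<alpha> \<gamma> 2 1 = 0" "row_residual \<alpha> \<gamma> 3 1 = 0" "row_residual \<alpha> \<gamma> 4 1 = 0"
    unfolding row_residual_def row_sum_expand using k(13-15)
    by (simp_all add: k(1,2,7-9) k1 power2_eq_square algebra_simps)
  have "i \<in> {1, 2, 3, 4}" if "i \<in> {1..4}" for i :: nat using that by auto
  then show "i \<in> {1..4} \<Longrightarrow> row_residual \<alpha> \<gamma> i 0 = 0 \<and> row_residual \<alpha> \<gamma> i 1 = 0"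
    using r0 r1 by blast
  show "row_residual \<alpha> \<gamma> 4 2 = 0"
    unfolding row_residual_def row_sum_expand using k(16)
    by (simp add: k(1,2,7-9) k1 fact_numeral power2_eq_square algebra_simps)
  show "row_residual \<alpha> \<gamma> 4 3 = 0"
    unfolding row_residual_def row_sum_expand using k(17)
    by (simp add: k(1,2,7-9) k1 fact_numeral power3_eq_cube algebra_simps)
  have s: "(\<Sum>j\<in>{1..<4}. f j) = f 1 + f 2 + f 3" for f :: "nat \<Rightarrow> real"
    by (simp add: eval_nat_numeral add.assoc)
  have "(\<Sum>j\<in>{1..<4}. \<alpha> 4 j * row_residual \<alpha> \<gamma> j 2) =
      (8 * c ^ 3 * \<alpha> 4 1 + (\<gamma> 2) ^ 3 * \<alpha> 4 2 + (\<gamma> 3) ^ 3 * \<alpha> 4 3) / 6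
      - (c * (4 * c\<^sup>2 * \<alpha> 4 1 + (\<gamma> 2)\<^sup>2 * \<alpha> 4 2 + (\<gamma> 3)\<^sup>2 * \<alpha> 4 3)
         + 2 * c * \<alpha> 4 2 * (2 * c * \<alpha> 2 1)
         + \<alpha> 4 3 * (2 * c * (2 * c * \<alpha> 3 1) + (\<gamma> 2)\<^sup>2 * \<alpha> 3 2)) / 2"
    unfolding s row_residual_def row_sum_expand
    by (simp add: k(1,2,7-9) k1 fact_numeral power2_eq_square power3_eq_cube field_simps)
  also have "\<dots> = (1 / 4 - c) / 6
      - (2 * c * (4 * c\<^sup>2 * \<alpha> 4 1 + (\<gamma> 2)\<^sup>2 * \<alpha> 4 2 + (\<gamma> 3)\<^sup>2 * \<alpha> 4 3)
       - 2 * c\<^sup>2 * (2 * c * \<alpha> 4 1 + \<gamma> 2 * \<alpha> 4 2 + \<gamma> 3 * \<alpha> 4 3)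
       + \<alpha> 4 3 * \<alpha> 3 2 * \<gamma> 2 * (\<gamma> 2 - 2 * c)) / 2"
    unfolding k(13,14,17) by (simp add: power2_eq_square field_simps)
  also have "2 * c * \<alpha> 4 1 + \<gamma> 2 * \<alpha> 4 2 + \<gamma> 3 * \<alpha> 4 3 = 1 / 2 - c" using k(15) by simp
  also have "(1 / 4 - c) / 6
      - (2 * c * (4 * c\<^sup>2 * \<alpha> 4 1 + (\<gamma> 2)\<^sup>2 * \<alpha> 4 2 + (\<gamma> 3)\<^sup>2 * \<alpha> 4 3)
       - 2 * c\<^sup>2 * (1 / 2 - c) + \<alpha> 4 3 * \<alpha> 3 2 * \<gamma> 2 * (\<gamma> 2 - 2 * c)) / 2 = 0"
    unfolding k(16,18) by (simp add: power2_eq_square power3_eq_cube field_simps)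
  finally show "(\<Sum>j\<in>{1..<4}. \<alpha> 4 j * row_residual \<alpha> \<gamma> j 2) = 0" .
qed

lemma re_im_bigo:
  assumes "f \<in> O[F](pw n)"
  shows "(\<lambda>h. p * Re (f h) + q * Im (f h)) \<in> O[F](\<lambda>h. h ^ n)"
proof -
  from landau_o.bigE[OF assms] obtain C where C: "eventually (\<lambda>h. norm (f h) \<le> C * norm (pw n h)) F" by blast
  show ?thesis
  proof (rule bigoI)
    show "eventually (\<lambda>h. norm (p * Re (f h) + q * Im (f h)) \<le> ((\<bar>p\<bar> + \<bar>q\<bar>) * C) * norm (h ^ n)) F"
      using C
    proof eventually_elim
      case (elim h)
      have "norm (p * Re (f h) + q * Im (f h)) \<le> \<bar>p\<bar> * \<bar>Re (f h)\<bar> + \<bar>q\<bar> * \<bar>Im (f h)\<bar>"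
        using abs_triangle_ineq[of "p * Re (f h)" "q * Im (f h)"] by (simp add: abs_mult)
      also have "\<dots> \<le> \<bar>p\<bar> * norm (f h) + \<bar>q\<bar> * norm (f h)"
        by (intro add_mono mult_left_mono abs_Re_le_cmod abs_Im_le_cmod) auto
      also have "\<dots> = (\<bar>p\<bar> + \<bar>q\<bar>) * norm (f h)" by (simp add: distrib_right)
      also have "\<dots> \<le> (\<bar>p\<bar> + \<bar>q\<bar>) * (C * norm (pw n h))" using elim by (intro mult_left_mono) auto
      finally show ?case by (simp add: norm_power mult.assoc power_abs)
    qed
  qed
qed

lemma suci4_accurate:
  assumes sp: "suci4_params \<alpha> \<gamma>"
  shows "accurate_of_order 4 4 \<alpha> \<gamma>"
  unfolding accurate_of_order_def
proof (intro allI impI ballI conjI)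
  fix \<omega> \<xi> :: real and i :: nat
  assume w: "\<omega> > 0" and xi: "\<xi> \<in> {0..<1}" and i: "i < 2"
  define \<mu> where "\<mu> = eig \<xi> \<omega>"
  have im: "Im \<mu> \<noteq> 0" using eig_props(1)[OF w xi] by (simp add: \<mu>_def)
  have 1: "1 - \<mu> \<noteq> 0" using im by (auto simp: complex_eq_iff)
  have g: "\<gamma> 0 = 0" "\<gamma> 4 = 1" using sp by (simp_all add: suci4_params_def)
  note oc = suci4_order_conditions[OF sp]
  note err = step_error_bigo[where s = 4 and \<alpha> = \<alpha> and \<gamma> = \<gamma> and \<mu> = \<mu>, OF g(1) oc(1) oc(2-4)]
  have pos: "eventually (\<lambda>h::real. h \<ge> 0) (at_right 0)"
    by (rule eventually_mono[OF eventually_at_right_less]) simp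
  define eD where "eD = (\<lambda>h. exp (of_real h * \<mu>) - stage \<alpha> (of_real h * \<mu>) (\<lambda>_. 0) 1 4)"
  have eD: "eD \<in> O[at_right 0](pw 5)"
    using err[of 0 1] by (simp add: eD_def[abs_def] g)
  define eL where "eL = (\<lambda>h. (exp (of_real h) - exp (of_real h * \<mu>)) / (1 - \<mu>) -
     stage \<alpha> (of_real h * \<mu>) (\<lambda>j. of_real (h * exp (0 + \<gamma> j * h))) 0 4)"
  have eL: "eL \<in> O[at_right 0](pw 5)"
    using err[of "1 / (1 - \<mu>)" "- 1 / (1 - \<mu>)"] 1 by (simp add: eL_def[abs_def] g exp_of_real[symmetric] diff_divide_distrib)
  show "(\<lambda>dt. L_num 4 \<alpha> \<gamma> \<xi> \<omega> exp 0 dt $ i - L_exa \<xi> \<omega> dt $ i) \<in> O[at_right 0](\<lambda>dt. dt ^ (4 + 1))"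
  proof -
    define p q where "p = (if i = 0 then 0 else - 1 :: real)"
      and "q = (if i = 0 then - 1 / Im \<mu> else - Re \<mu> / Im \<mu>)"
    have "eventually (\<lambda>dt. p * Re (eL dt) + q * Im (eL dt) =
       L_num 4 \<alpha> \<gamma> \<xi> \<omega> exp 0 dt $ i - L_exa \<xi> \<omega> dt $ i) (at_right 0)"
      using pos
    proof eventually_elim
      case (elim dt)
      show ?case
        unfolding num_eq(2)[where \<gamma> = \<gamma>, OF w xi g(1), folded \<mu>_def] exa_eq(2)[OF w xi elim, folded \<mu>_def]
        using i im by (cases "i = 0") (auto simp: less_2_cases_iff p_def q_def eL_def field_simps)
    qed
    from landau_o.big.in_cong[OF this] re_im_bigo[OF eL, of p q] show ?thesis by simp
  qed
  fix j :: nat assume j: "j < 2"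
  show "(\<lambda>dt. D_num 4 \<alpha> \<gamma> \<xi> \<omega> dt $$ (i, j) - D_exa \<xi> \<omega> dt $$ (i, j)) \<in> O[at_right 0](\<lambda>dt. dt ^ (4 + 1))"
  proof -
    define p q where "p = (if i = j then - 1 else 0 :: real)"
      and "q = (if i = j then if i = 0 then Re \<mu> / Im \<mu> else - Re \<mu> / Im \<mu>
         else if i = 0 then - 1 / Im \<mu> else (norm \<mu>)\<^sup>2 / Im \<mu>)"
    have "eventually (\<lambda>dt. p * Re (eD dt) + q * Im (eD dt) =
       D_num 4 \<alpha> \<gamma> \<xi> \<omega> dt $$ (i, j) - D_exa \<xi> \<omega> dt $$ (i, j)) (at_right 0)"
      using pos
    proof eventually_elim
      case (elim dt)
      show ?case
        unfolding num_eq(1)[where \<gamma> = \<gamma>, OF w xi g(1), folded \<mu>_def] exa_eq(1)[OF w xi elim, folded \<mu>_def]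
        using i j im by (auto simp: less_2_cases_iff p_def q_def eD_def field_simps)
    qed
    from landau_o.big.in_cong[OF this] re_im_bigo[OF eD, of p q] show ?thesis by simp
  qed
qed

section \<open>The stability function\<close>

text \<open>The Taylor polynomial of degree four of \<open>exp z * (1 - c z) ^ 4\<close>.\<close>
definition suci4_num :: "real \<Rightarrow> complex \<Rightarrow> complex" where
  "suci4_num c z = 1 + of_real (1 - 4 * c) * z + of_real (1/2 - 4 * c + 6 * c\<^sup>2) * z\<^sup>2
     + of_real (1/6 - 2 * c + 6 * c\<^sup>2 - 4 * c ^ 3) * z ^ 3
     + of_real (1/24 - 2/3 * c + 3 * c\<^sup>2 - 4 * c ^ 3 + c ^ 4) * z ^ 4"

lemma sum_lessThan_small:
  "(\<Sum>j<1. f j) = f 0" "(\<Sum>j<2. f j) = f 0 + f 1" "(\<Sum>j<3. f j) = f 0 + f 1 + f 2"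
  "(\<Sum>j<4. f j) = f 0 + f 1 + f 2 + f 3" for f :: "nat \<Rightarrow> 'a :: comm_monoid_add"
  by (simp_all add: eval_nat_numeral add.assoc)

lemma stage_homogeneous:
  assumes "i > 0" "1 - of_real (\<alpha> i i) * z \<noteq> 0"
  shows "(1 - of_real (\<alpha> i i) * z) * stage \<alpha> z (\<lambda>_. 0) 1 i =
    1 + z * (\<Sum>j<i. of_real (\<alpha> i j) * stage \<alpha> z (\<lambda>_. 0) 1 j)"
  unfolding stage.simps[of _ _ _ _ i] using assms by (simp add: sum_distrib_left mult_ac)

text \<open>Multiplying stage \<open>i\<close> by \<open>(1 - c z) ^ i\<close> clears the denominators, and the coefficients of these
  polynomials are reduced with the order conditions one stage after the other.\<close>
lemma suci4_stability_function:
  assumes sp: "suci4_params \<alpha> \<gamma>" and nz: "1 - of_real (\<gamma> 1 / 2) * z \<noteq> 0"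
  shows "stage \<alpha> z (\<lambda>_. 0) 1 4 = suci4_num (\<gamma> 1 / 2) z / (1 - of_real (\<gamma> 1 / 2) * z) ^ 4"
proof -
  define c where "c = \<gamma> 1 / 2"
  note k = suci4_conditions[OF sp, folded c_def]
  define d where "d = 1 - of_real c * z"
  have d: "d \<noteq> 0" using nz by (simp add: d_def c_def)
  define w where "w = stage \<alpha> z (\<lambda>_. 0) 1"
  have w0: "w 0 = 1" by (simp add: w_def)
  note st = stage_homogeneous[of _ \<alpha> z, folded w_def]
  have w1: "d * w 1 = 1 + of_real c * z"
    using st[of 1] d unfolding sum_lessThan_small k(5,6) by (simp add: d_def w0 mult.commute)
  have w2: "d * w 2 = 1 + z * (of_real (\<alpha> 2 0) + of_real (\<alpha> 2 1) * w 1)"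
    using st[of 2] d unfolding sum_lessThan_small by (simp add: k(5-9) d_def w0)
  have w3: "d * w 3 = 1 + z * (of_real (\<alpha> 3 0) + of_real (\<alpha> 3 1) * w 1 + of_real (\<alpha> 3 2) * w 2)"
    using st[of 3] d unfolding sum_lessThan_small by (simp add: k(5-9) d_def w0)
  have w4: "d * w 4 = 1 + z * (of_real (\<alpha> 4 0) + of_real (\<alpha> 4 1) * w 1 + of_real (\<alpha> 4 2) * w 2 + of_real (\<alpha> 4 3) * w 3)"
    using st[of 4] d unfolding sum_lessThan_small by (simp add: k(5-9) d_def w0)
  have n2: "d\<^sup>2 * w 2 = 1 + of_real (\<gamma> 2 - 2 * c) * z + of_real ((\<gamma> 2)\<^sup>2 / 2 - 2 * c * \<gamma> 2 + c\<^sup>2) * z\<^sup>2"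
  proof -
    have "d\<^sup>2 * w 2 = d * (d * w 2)" by (simp add: power2_eq_square)
    also have "\<dots> = d * (1 + of_real (\<alpha> 2 0) * z) + of_real (\<alpha> 2 1) * z * (d * w 1)"
      unfolding w2 by (simp add: algebra_simps)
    also have "\<dots> = 1 + of_real (\<gamma> 2 - 2 * c) * z + of_real (2 * c * \<alpha> 2 1 - c * (\<gamma> 2 - c)) * z\<^sup>2"
      unfolding w1 unfolding d_def k(10) by (simp add: power2_eq_square algebra_simps)
    finally show ?thesis unfolding k(13) by (simp add: power2_eq_square algebra_simps)
  qed
  have n3: "d ^ 3 * w 3 = 1 + of_real (\<gamma> 3 - 3 * c) * z + of_real ((\<gamma> 3)\<^sup>2 / 2 - 3 * c * \<gamma> 3 + 3 * c\<^sup>2) * z\<^sup>2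
     + of_real (2 * c\<^sup>2 * \<gamma> 3 - c ^ 3 - c * (\<gamma> 3)\<^sup>2 / 2 + \<alpha> 3 2 * \<gamma> 2 * (\<gamma> 2 - 2 * c) / 2) * z ^ 3"
  proof -
    have "d ^ 3 * w 3 = d\<^sup>2 * (d * w 3)" by (simp add: power2_eq_square power3_eq_cube)
    also have "\<dots> = d\<^sup>2 * (1 + of_real (\<alpha> 3 0) * z) + of_real (\<alpha> 3 1) * z * d * (d * w 1) + of_real (\<alpha> 3 2) * z * (d\<^sup>2 * w 2)"
      unfolding w3 by (simp add: power2_eq_square algebra_simps)
    also have "\<dots> = 1 + of_real (\<gamma> 3 - 3 * c) * z + of_real (3 * c\<^sup>2 - 2 * c * \<gamma> 3 + 2 * c * \<alpha> 3 1 + \<gamma> 2 * \<alpha> 3 2) * z\<^sup>2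
       + of_real (c\<^sup>2 * (\<gamma> 3 - c - \<alpha> 3 2) - c * (2 * c * \<alpha> 3 1) + \<alpha> 3 2 * ((\<gamma> 2)\<^sup>2 / 2 - 2 * c * \<gamma> 2 + c\<^sup>2)) * z ^ 3"
      unfolding w1 n2 unfolding d_def k(11) by (simp add: power2_eq_square power3_eq_cube algebra_simps)
    also have "3 * c\<^sup>2 - 2 * c * \<gamma> 3 + 2 * c * \<alpha> 3 1 + \<gamma> 2 * \<alpha> 3 2 = (\<gamma> 3)\<^sup>2 / 2 - 3 * c * \<gamma> 3 + 3 * c\<^sup>2"
      unfolding k(14) by simp
    also have "c\<^sup>2 * (\<gamma> 3 - c - \<alpha> 3 2) - c * (2 * c * \<alpha> 3 1) + \<alpha> 3 2 * ((\<gamma> 2)\<^sup>2 / 2 - 2 * c * \<gamma> 2 + c\<^sup>2) =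
       2 * c\<^sup>2 * \<gamma> 3 - c ^ 3 - c * (\<gamma> 3)\<^sup>2 / 2 + \<alpha> 3 2 * \<gamma> 2 * (\<gamma> 2 - 2 * c) / 2"
      unfolding k(14) by (simp add: field_simps power2_eq_square power3_eq_cube)
    finally show ?thesis .
  qed
  define n21 n22 where "n21 = \<gamma> 2 - 2 * c" and "n22 = (\<gamma> 2)\<^sup>2 / 2 - 2 * c * \<gamma> 2 + c\<^sup>2"
  define n31 n32 n33 where "n31 = \<gamma> 3 - 3 * c" and "n32 = (\<gamma> 3)\<^sup>2 / 2 - 3 * c * \<gamma> 3 + 3 * c\<^sup>2"
    and "n33 = 2 * c\<^sup>2 * \<gamma> 3 - c ^ 3 - c * (\<gamma> 3)\<^sup>2 / 2 + \<alpha> 3 2 * \<gamma> 2 * (\<gamma> 2 - 2 * c) / 2"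
  define N1 where "N1 = \<alpha> 4 0 - 3 * c + \<alpha> 4 1 + \<alpha> 4 2 + \<alpha> 4 3"
  define N2 where "N2 = 3 * c\<^sup>2 - 3 * c * \<alpha> 4 0 - c * \<alpha> 4 1 + \<alpha> 4 2 * (n21 - c) + \<alpha> 4 3 * n31"
  define N3 where "N3 = - (c ^ 3) + 3 * c\<^sup>2 * \<alpha> 4 0 - c\<^sup>2 * \<alpha> 4 1 + \<alpha> 4 2 * (n22 - c * n21) + \<alpha> 4 3 * n32"
  define N4 where "N4 = - (c ^ 3) * \<alpha> 4 0 + c ^ 3 * \<alpha> 4 1 - c * \<alpha> 4 2 * n22 + \<alpha> 4 3 * n33"
  have q1: "2 * c * \<alpha> 4 1 + \<gamma> 2 * \<alpha> 4 2 + \<gamma> 3 * \<alpha> 4 3 = 1 / 2 - c" using k(15) by simp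
  have "d ^ 4 * w 4 = d ^ 3 * (d * w 4)" by (simp add: power_numeral_reduce)
  also have "\<dots> = d ^ 3 * (1 + of_real (\<alpha> 4 0) * z) + of_real (\<alpha> 4 1) * z * d\<^sup>2 * (d * w 1)
     + of_real (\<alpha> 4 2) * z * d * (d\<^sup>2 * w 2) + of_real (\<alpha> 4 3) * z * (d ^ 3 * w 3)"
    unfolding w4 by (simp add: power2_eq_square power3_eq_cube algebra_simps)
  also have "\<dots> = 1 + of_real N1 * z + of_real N2 * z\<^sup>2 + of_real N3 * z ^ 3 + of_real N4 * z ^ 4"
    unfolding w1 n2[folded n21_def n22_def] n3[folded n31_def n32_def n33_def]
    unfolding d_def N1_def N2_def N3_def N4_def
    by (simp add: power2_eq_square power3_eq_cube power4_eq_xxxx algebra_simps)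
  also have "N1 = 1 - 4 * c" unfolding N1_def k(12) by simp
  also have "N2 = 1/2 - 4 * c + 6 * c\<^sup>2"
    using k(15) unfolding N2_def k(12) n21_def n31_def by (simp add: power2_eq_square algebra_simps)
  also have "N3 = 1/6 - 2 * c + 6 * c\<^sup>2 - 4 * c ^ 3"
  proof -
    have "N3 = - 4 * c ^ 3 + 3 * c\<^sup>2 + (4 * c\<^sup>2 * \<alpha> 4 1 + (\<gamma> 2)\<^sup>2 * \<alpha> 4 2 + (\<gamma> 3)\<^sup>2 * \<alpha> 4 3) / 2
         - 3 * c * (2 * c * \<alpha> 4 1 + \<gamma> 2 * \<alpha> 4 2 + \<gamma> 3 * \<alpha> 4 3)"
      unfolding N3_def k(12) n21_def n22_def n32_def
      by (simp add: field_simps power2_eq_square power3_eq_cube)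
    then show ?thesis unfolding k(16) q1 by (simp add: field_simps power2_eq_square power3_eq_cube)
  qed
  also have "N4 = 1/24 - 2/3 * c + 3 * c\<^sup>2 - 4 * c ^ 3 + c ^ 4"
  proof -
    have "N4 = - (c ^ 3) + c ^ 4 - c * (4 * c\<^sup>2 * \<alpha> 4 1 + (\<gamma> 2)\<^sup>2 * \<alpha> 4 2 + (\<gamma> 3)\<^sup>2 * \<alpha> 4 3) / 2
         + 2 * c\<^sup>2 * (2 * c * \<alpha> 4 1 + \<gamma> 2 * \<alpha> 4 2 + \<gamma> 3 * \<alpha> 4 3)
         + \<alpha> 4 3 * \<alpha> 3 2 * \<gamma> 2 * (\<gamma> 2 - 2 * c) / 2"
      unfolding N4_def k(12) n22_def n33_def
      by (simp add: field_simps power2_eq_square power3_eq_cube power4_eq_xxxx)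
    then show ?thesis unfolding k(16) k(18) q1
      by (simp add: field_simps power2_eq_square power3_eq_cube power4_eq_xxxx)
  qed
  finally have "d ^ 4 * w 4 = suci4_num c z" unfolding suci4_num_def .
  moreover have "d ^ 4 \<noteq> 0" using d by simp
  ultimately have "w 4 = suci4_num c z / d ^ 4" using nonzero_eq_divide_eq[of "d ^ 4" "w 4"] by (simp add: mult.commute)
  then show ?thesis unfolding w_def d_def c_def .
qed

lemma suci4_D_num:
  fixes dt :: real
  assumes sp: "suci4_params \<alpha> \<gamma>" and w: "\<omega> > 0" and xi: "\<xi> \<in> {0..<1}"
  defines "c \<equiv> \<gamma> 1 / 2" and "z \<equiv> of_real dt * eig \<xi> \<omega>"
  shows "D_num 4 \<alpha> \<gamma> \<xi> \<omega> dt = modal_mat (eig \<xi> \<omega>) (suci4_num c z / (1 - of_real c * z) ^ 4)"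
proof -
  have im: "Im (eig \<xi> \<omega>) > 0" by (rule eig_props(1)[OF w xi])
  have "1 - of_real (\<gamma> 1 / 2) * z \<noteq> 0" using im by (auto simp: z_def complex_eq_iff)
  from suci4_stability_function[OF sp this]
  have "stage \<alpha> z (\<lambda>_. 0) 1 4 = suci4_num c z / (1 - of_real c * z) ^ 4" unfolding c_def .
  moreover have "\<gamma> 0 = 0" using sp by (simp add: suci4_params_def)
  ultimately show ?thesis using num_eq(1)[where \<gamma> = \<gamma>, OF w xi] by (simp add: z_def)
qed

text \<open>Up to positive factors, the coefficients of \<open>y\<^sup>6\<close> and \<open>y\<^sup>8\<close> in the difference of the squared moduli of
  denominator and numerator of the stability function at \<open>i y\<close>, in terms of \<open>g = 2 c\<close>.\<close>
definition gap6 :: "real \<Rightarrow> real" where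
  "gap6 g = 2 - 24 * g + 102 * g\<^sup>2 - 192 * g ^ 3 + 153 * g ^ 4 - 36 * g ^ 5"
definition gap8 :: "real \<Rightarrow> real" where
  "gap8 g = (2 * g - 1) * (6 * g\<^sup>2 - 6 * g + 1) * (3 * (g - 1) ^ 4 + 4 * g - 2)"

text \<open>The powers \<open>y\<^sup>2\<close> and \<open>y\<^sup>4\<close> vanish since the stability function agrees with \<open>exp\<close> up to fourth order and
  \<open>exp (i y)\<close> has modulus one. The coefficient of \<open>y\<^sup>8\<close> is \<open>c\<^sup>8 - p4\<^sup>2\<close>, hence a product.\<close>
lemma stability_gap:
  "576 * ((1 + c\<^sup>2 * y\<^sup>2) ^ 4 - (norm (suci4_num c (\<i> * of_real y)))\<^sup>2)
     = y ^ 6 * (4 * gap6 (2 * c) + gap8 (2 * c) * y\<^sup>2)"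
proof -
  define p2 p3 p4 where "p2 = 1/2 - 4 * c + 6 * c\<^sup>2" and "p3 = 1/6 - 2 * c + 6 * c\<^sup>2 - 4 * c ^ 3"
    and "p4 = 1/24 - 2/3 * c + 3 * c\<^sup>2 - 4 * c ^ 3 + c ^ 4"
  have "suci4_num c (\<i> * of_real y) = Complex (1 - p2 * y\<^sup>2 + p4 * y ^ 4) ((1 - 4 * c) * y - p3 * y ^ 3)"
    unfolding suci4_num_def p2_def[symmetric] p3_def[symmetric] p4_def[symmetric]
    by (simp add: complex_eq_iff power_numeral_reduce algebra_simps)
  then have n: "(norm (suci4_num c (\<i> * of_real y)))\<^sup>2 =
      (1 - p2 * y\<^sup>2 + p4 * y ^ 4)\<^sup>2 + ((1 - 4 * c) * y - p3 * y ^ 3)\<^sup>2"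
    by (simp add: cmod_power2)
  have "(1 + c\<^sup>2 * y\<^sup>2) ^ 4 - ((1 - p2 * y\<^sup>2 + p4 * y ^ 4)\<^sup>2 + ((1 - 4 * c) * y - p3 * y ^ 3)\<^sup>2)
     = (4 * c\<^sup>2 + 2 * p2 - (1 - 4 * c)\<^sup>2) * y\<^sup>2
       + (6 * c ^ 4 - p2\<^sup>2 - 2 * p4 + 2 * (1 - 4 * c) * p3) * y ^ 4
       + (4 * c ^ 6 + 2 * p2 * p4 - p3\<^sup>2) * y ^ 6 + (c ^ 8 - p4\<^sup>2) * y ^ 8"
    by (simp add: power_numeral_reduce algebra_simps)
  also have "4 * c\<^sup>2 + 2 * p2 - (1 - 4 * c)\<^sup>2 = 0"
    by (simp add: p2_def power2_eq_square algebra_simps)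
  also have "6 * c ^ 4 - p2\<^sup>2 - 2 * p4 + 2 * (1 - 4 * c) * p3 = 0"
    by (simp add: p2_def p3_def p4_def power_numeral_reduce algebra_simps)
  also have "4 * c ^ 6 + 2 * p2 * p4 - p3\<^sup>2 = gap6 (2 * c) / 144"
    by (simp add: p2_def p3_def p4_def gap6_def power_numeral_reduce field_simps)
  also have "c ^ 8 - p4\<^sup>2 = gap8 (2 * c) / 576"
  proof -
    have f: "(2 * (2 * c) - 1) * (6 * (2 * c)\<^sup>2 - 6 * (2 * c) + 1) = 24 * (c ^ 4 - p4)"
      "3 * (2 * c - 1) ^ 4 + 4 * (2 * c) - 2 = 24 * (c ^ 4 + p4)"
      by (simp_all add: p4_def power_numeral_reduce algebra_simps)
    show ?thesis unfolding gap8_def f by (simp add: power_numeral_reduce algebra_simps)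
  qed
  finally show ?thesis unfolding n by (simp add: power_numeral_reduce algebra_simps)
qed

text \<open>Small \<open>y\<close> gives the first condition and large \<open>y\<close> the second.\<close>
lemma nonneg_quadratic_iff:
  fixes p q :: real
  shows "(\<forall>y\<ge>0. y ^ 6 * (p + q * y\<^sup>2) \<ge> 0) \<longleftrightarrow> p \<ge> 0 \<and> q \<ge> 0"
proof
  assume H: "\<forall>y\<ge>0. y ^ 6 * (p + q * y\<^sup>2) \<ge> 0"
  have pos: "p + q * x \<ge> 0" if "x > 0" for x
  proof -
    have "sqrt x ^ 6 * (p + q * (sqrt x)\<^sup>2) \<ge> 0" using H[rule_format, of "sqrt x"] that by simp
    then show ?thesis using that by (simp add: zero_le_mult_iff)
  qed
  have "((\<lambda>x. p + q * x) \<longlongrightarrow> p + q * 0) (at_right 0)" by (intro tendsto_intros)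
  then have "0 \<le> p + q * 0"
    by (rule tendsto_lowerbound) (auto intro: eventually_mono[OF eventually_at_right_less[of 0]] pos)
  then have p: "p \<ge> 0" by simp
  moreover have "q \<ge> 0"
  proof (rule ccontr)
    assume "\<not> q \<ge> 0"
    then have "p + q * ((p + 1) / - q) = - 1" "(p + 1) / - q > 0" using p by (auto simp: field_simps)
    \<comment> \<open>At this point the linear function takes the value \<open>- 1\<close>.\<close>
    with pos[of "(p + 1) / - q"] show False by simp
  qed
  ultimately show "p \<ge> 0 \<and> q \<ge> 0" by simp
qed auto

lemma suci4_stable_iff:
  assumes sp: "suci4_params \<alpha> \<gamma>"
  shows "unconditionally_stable 4 \<alpha> \<gamma> \<longleftrightarrow> gap6 (\<gamma> 1) \<ge> 0 \<and> gap8 (\<gamma> 1) \<ge> 0"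
proof -
  define c where "c = \<gamma> 1 / 2"
  have eig0: "eig 0 \<omega> = \<i> * of_real \<omega>" for \<omega> by (simp add: eig_def complex_eq_iff)
  define r where "r = (\<lambda>y. suci4_num c (\<i> * of_real y) / (1 - of_real c * (\<i> * of_real y)) ^ 4)"
  have sr: "spectral_radius (map_mat complex_of_real (D_num 4 \<alpha> \<gamma> 0 \<omega> dt)) = norm (r (\<omega> * dt))"
    if w: "\<omega> > 0" for \<omega> dt
  proof -
    have im: "Im (eig 0 \<omega>) \<noteq> 0" using w by (simp add: eig_def)
    have z: "of_real dt * eig 0 \<omega> = \<i> * of_real (\<omega> * dt)" by (simp add: eig0)
    show ?thesis
      unfolding suci4_D_num[OF sp w, of 0, simplified] spectral_radius_modal_mat[OF im] z
      by (simp add: r_def c_def)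
  qed
  have "unconditionally_stable 4 \<alpha> \<gamma> \<longleftrightarrow> (\<forall>y\<ge>0. norm (r y) \<le> 1)"
  proof
    assume H: "unconditionally_stable 4 \<alpha> \<gamma>"
    show "\<forall>y\<ge>0. norm (r y) \<le> 1"
    proof (intro allI impI)
      fix y :: real assume "y \<ge> 0"
      then have "spectral_radius (map_mat complex_of_real (D_num 4 \<alpha> \<gamma> 0 1 y)) \<le> 1"
        using H unfolding unconditionally_stable_def by simp
      then show "norm (r y) \<le> 1" using sr[of 1 y] by simp
    qed
  next
    assume "\<forall>y\<ge>0. norm (r y) \<le> 1"
    then show "unconditionally_stable 4 \<alpha> \<gamma>" unfolding unconditionally_stable_def using sr by simp
  qed
  also have "\<dots> \<longleftrightarrow> (\<forall>y\<ge>0. y ^ 6 * (4 * gap6 (2 * c) + gap8 (2 * c) * y\<^sup>2) \<ge> 0)"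
  proof -
    have "norm (r y) \<le> 1 \<longleftrightarrow> y ^ 6 * (4 * gap6 (2 * c) + gap8 (2 * c) * y\<^sup>2) \<ge> 0" for y
    proof -
      let ?d = "1 - of_real c * (\<i> * of_real y)" and ?n = "suci4_num c (\<i> * of_real y)"
      have d2: "(norm ?d)\<^sup>2 = 1 + c\<^sup>2 * y\<^sup>2" by (simp add: cmod_power2 power_mult_distrib)
      have d0: "norm ?d > 0" by (simp add: complex_eq_iff)
      have "norm (r y) \<le> 1 \<longleftrightarrow> norm ?n \<le> norm ?d ^ 4"
        using d0 by (simp add: r_def norm_divide norm_power)
      also have "\<dots> \<longleftrightarrow> (norm ?n)\<^sup>2 \<le> (norm ?d ^ 4)\<^sup>2"
        by (rule power_mono_iff[symmetric]) simp_all
      also have "(norm ?d ^ 4)\<^sup>2 = (1 + c\<^sup>2 * y\<^sup>2) ^ 4" unfolding d2[symmetric] by (simp add: power_mult[symmetric])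
      finally show ?thesis unfolding stability_gap[symmetric] by simp
    qed
    then show ?thesis by simp
  qed
  also have "\<dots> \<longleftrightarrow> gap6 (\<gamma> 1) \<ge> 0 \<and> gap8 (\<gamma> 1) \<ge> 0"
    unfolding nonneg_quadratic_iff by (simp add: c_def)
  finally show ?thesis .
qed

section \<open>The stability interval\<close>

text \<open>The proof writes the polynomial in the Bernstein basis of two subintervals, after moving it up by
  a small constant; all coefficients then have the same sign.\<close>
lemma gap6_neg:
  assumes "1/5 \<le> g" "g \<le> 1/2" shows "gap6 g < 0"
proof (cases "g \<le> 1/3")
  case True
  with assms(1) have g: "5 * g - 1 \<ge> 0" "1 - 3 * g \<ge> 0" by simp_all
  have "3200 * gap6 g = - 32 - (3975 * (1 - 3 * g) ^ 5
      + 52725 * (5 * g - 1) * (1 - 3 * g) ^ 4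
      + 70950 * (5 * g - 1) ^ 2 * (1 - 3 * g) ^ 3
      + 35850 * (5 * g - 1) ^ 3 * (1 - 3 * g) ^ 2
      + 7875 * (5 * g - 1) ^ 4 * (1 - 3 * g)
      + 657 * (5 * g - 1) ^ 5)"
    by (simp add: gap6_def power_numeral_reduce algebra_simps)
  moreover have "3975 * (1 - 3 * g) ^ 5
      + 52725 * (5 * g - 1) * (1 - 3 * g) ^ 4
      + 70950 * (5 * g - 1) ^ 2 * (1 - 3 * g) ^ 3
      + 35850 * (5 * g - 1) ^ 3 * (1 - 3 * g) ^ 2
      + 7875 * (5 * g - 1) ^ 4 * (1 - 3 * g)
      + 657 * (5 * g - 1) ^ 5 \<ge> 0"
    using g by (intro add_nonneg_nonneg mult_nonneg_nonneg zero_le_power) auto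
  ultimately show ?thesis by linarith
next
  case False
  with assms(2) have g: "3 * g - 1 \<ge> 0" "1 - 2 * g \<ge> 0" by simp_all
  have "100 * gap6 g = - 1 - (657 * (1 - 2 * g) ^ 5
      + 990 * (3 * g - 1) * (1 - 2 * g) ^ 4
      + 120 * (3 * g - 1) ^ 2 * (1 - 2 * g) ^ 3
      + 480 * (3 * g - 1) ^ 3 * (1 - 2 * g) ^ 2
      + 660 * (3 * g - 1) ^ 4 * (1 - 2 * g)
      + 168 * (3 * g - 1) ^ 5)"
    by (simp add: gap6_def power_numeral_reduce algebra_simps)
  moreover have "657 * (1 - 2 * g) ^ 5
      + 990 * (3 * g - 1) * (1 - 2 * g) ^ 4
      + 120 * (3 * g - 1) ^ 2 * (1 - 2 * g) ^ 3
      + 480 * (3 * g - 1) ^ 3 * (1 - 2 * g) ^ 2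
      + 660 * (3 * g - 1) ^ 4 * (1 - 2 * g)
      + 168 * (3 * g - 1) ^ 5 \<ge> 0"
    using g by (intro add_nonneg_nonneg mult_nonneg_nonneg zero_le_power) auto
  ultimately show ?thesis by linarith
qed

lemma gap6_pos:
  assumes "3/4 \<le> g" "g \<le> 5/2" shows "gap6 g > 0"
proof -
  have g: "4 * g - 3 \<ge> 0" "5 - 2 * g \<ge> 0" using assms by simp_all
  have "1344560 * gap6 g = 268912 + (108 * (5 - 2 * g) ^ 5
      + 14235 * (4 * g - 3) * (5 - 2 * g) ^ 4
      + 95820 * (4 * g - 3) ^ 2 * (5 - 2 * g) ^ 3
      + 233130 * (4 * g - 3) ^ 3 * (5 - 2 * g) ^ 2
      + 195360 * (4 * g - 3) ^ 4 * (5 - 2 * g)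
      + 3219 * (4 * g - 3) ^ 5)"
    by (simp add: gap6_def power_numeral_reduce algebra_simps)
  moreover have "108 * (5 - 2 * g) ^ 5
      + 14235 * (4 * g - 3) * (5 - 2 * g) ^ 4
      + 95820 * (4 * g - 3) ^ 2 * (5 - 2 * g) ^ 3
      + 233130 * (4 * g - 3) ^ 3 * (5 - 2 * g) ^ 2
      + 195360 * (4 * g - 3) ^ 4 * (5 - 2 * g)
      + 3219 * (4 * g - 3) ^ 5 \<ge> 0"
    using g by (intro add_nonneg_nonneg mult_nonneg_nonneg zero_le_power) auto
  ultimately show ?thesis by linarith
qed

lemma gap6_decreasing:
  assumes "5/2 \<le> x" "x < y" shows "gap6 y < gap6 x"
proof -
  define s t where "s = x - 5/2" and "t = y - 5/2"
  have st: "0 \<le> s" "s < t" using assms by (simp_all add: s_def t_def)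
  have sh: "gap6 (5/2 + u) = 647/16 - (2331/4 * u + 2451/2 * u\<^sup>2 + 912 * u ^ 3 + 297 * u ^ 4 + 36 * u ^ 5)" for u
    by (simp add: gap6_def power_numeral_reduce field_simps)
  have "s\<^sup>2 \<le> t\<^sup>2" "s ^ 3 \<le> t ^ 3" "s ^ 4 \<le> t ^ 4" "s ^ 5 \<le> t ^ 5"
    using st by (auto intro: power_mono)
  then have "gap6 (5/2 + t) < gap6 (5/2 + s)" unfolding sh using st by linarith
  then show ?thesis by (simp add: s_def t_def)
qed

text \<open>The lower end of the stability interval, a root of \<open>6 g\<^sup>2 - 6 g + 1\<close>.\<close>
definition gamma_min :: real where "gamma_min = (3 + sqrt 3) / 6"

lemma gamma_min_bounds: "78867513/10^8 < gamma_min" "gamma_min < 78867514/10^8"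
proof -
  have "173205078/10^8 < sqrt 3" by (rule real_less_rsqrt) (simp add: power2_eq_square)
  moreover have "sqrt 3 < 1732050808/10^9" by (rule real_less_lsqrt) (simp_all add: power2_eq_square)
  ultimately show "78867513/10^8 < gamma_min" "gamma_min < 78867514/10^8" by (simp_all add: gamma_min_def)
qed

lemma gamma_min_root: "6 * gamma_min\<^sup>2 - 6 * gamma_min + 1 = 0"
  by (simp add: gamma_min_def power2_eq_square field_simps)

lemma gamma_min_factor: "6 * g\<^sup>2 - 6 * g + 1 = 6 * (g - gamma_min) * (g - (1 - gamma_min))"
proof -
  have "6 * g\<^sup>2 - 6 * g + 1 - (6 * gamma_min\<^sup>2 - 6 * gamma_min + 1) = 6 * (g - gamma_min) * (g - (1 - gamma_min))"
    by (simp add: power2_eq_square algebra_simps)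
  then show ?thesis using gamma_min_root by simp
qed

lemma quartic_pos:
  fixes g :: real
  assumes "g \<ge> 1/2" shows "3 * (g - 1) ^ 4 + 4 * g - 2 > 0"
proof (cases "g = 1/2")
  case True
  show ?thesis unfolding True by (simp add: power_numeral_reduce)
next
  case False
  with assms have "4 * g - 2 > 0" by simp
  moreover have "3 * (g - 1) ^ 4 \<ge> 0" by simp
  ultimately show ?thesis by linarith
qed

lemma gap6_root: "\<exists>b. 256115952/10^8 \<le> b \<and> b \<le> 256115953/10^8 \<and> gap6 b = 0"
proof (rule IVT2)
  show "gap6 (256115953/10^8) \<le> 0" "0 \<le> gap6 (256115952/10^8)"
    by (simp_all add: gap6_def power_numeral_reduce)
qed (auto simp: gap6_def[abs_def])

text \<open>Below \<open>gamma_min\<close> the first two factors of \<open>gap8\<close> have a negative product, except between the other two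
  roots \<open>1 - gamma_min\<close> and \<open>1 / 2\<close>, and there \<open>gap6\<close> is negative. Above \<open>gamma_min\<close> only \<open>gap6\<close> matters; it is
  positive up to \<open>5 / 2\<close> and decreases from there on.\<close>
lemma stability_interval:
  assumes b: "256115952/10^8 \<le> b" "b \<le> 256115953/10^8" "gap6 b = 0" and g: "g > 0"
  shows "gap6 g \<ge> 0 \<and> gap8 g \<ge> 0 \<longleftrightarrow> gamma_min \<le> g \<and> g \<le> b"
proof
  assume L: "gap6 g \<ge> 0 \<and> gap8 g \<ge> 0"
  have "g \<le> b"
  proof (rule ccontr)
    assume "\<not> g \<le> b"
    then have "gap6 g < gap6 b" using b(1) by (intro gap6_decreasing) auto
    then show False using L b(3) by simp
  qed
  moreover have "gamma_min \<le> g"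
  proof (rule ccontr)
    assume n: "\<not> gamma_min \<le> g"
    have out: "\<not> (1/5 \<le> g \<and> g \<le> 1/2)" using gap6_neg[of g] L by auto
    have q: "g - gamma_min < 0" using n by simp
    consider "g < 1 - gamma_min" | "1/2 < g" using out gamma_min_bounds(2) by fastforce
    then show False
    proof cases
      case 1
      then have "(2 * g - 1) * (6 * g\<^sup>2 - 6 * g + 1) < 0"
        unfolding gamma_min_factor using q gamma_min_bounds mult_neg_neg[of "6 * (g - gamma_min)" "g - (1 - gamma_min)"]
        by (intro mult_neg_pos) auto
      moreover have "3 * (g - 1) ^ 4 + 4 * g - 2 > 0"
      proof -
        \<comment> \<open>The third factor of \<open>gap8\<close> and the product of the other two add up to \<open>3 g ^ 4\<close>.\<close>
        have "3 * (g - 1) ^ 4 + 4 * g - 2 = 3 * g ^ 4 - (2 * g - 1) * (6 * g\<^sup>2 - 6 * g + 1)"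
          by (simp add: power_numeral_reduce algebra_simps)
        moreover have "3 * g ^ 4 > 0" using g by simp
        ultimately show ?thesis using \<open>(2 * g - 1) * (6 * g\<^sup>2 - 6 * g + 1) < 0\<close> by linarith
      qed
      ultimately have "gap8 g < 0" unfolding gap8_def by (rule mult_neg_pos)
      then show False using L by simp
    next
      case 2
      have q6: "6 * (g - gamma_min) * (g - (1 - gamma_min)) < 0"
        by (rule mult_neg_pos) (use 2 q gamma_min_bounds in auto)
      have "(2 * g - 1) * (6 * g\<^sup>2 - 6 * g + 1) < 0"
        unfolding gamma_min_factor by (rule mult_pos_neg[OF _ q6]) (use 2 in simp)
      moreover have "3 * (g - 1) ^ 4 + 4 * g - 2 > 0" using 2 by (intro quartic_pos) simp
      ultimately have "gap8 g < 0" unfolding gap8_def by (rule mult_neg_pos)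
      then show False using L by simp
    qed
  qed
  ultimately show "gamma_min \<le> g \<and> g \<le> b" by simp
next
  assume R: "gamma_min \<le> g \<and> g \<le> b"
  have "gap8 g \<ge> 0" unfolding gap8_def gamma_min_factor
    using R gamma_min_bounds quartic_pos[of g] by (intro mult_nonneg_nonneg) auto
  moreover have "gap6 g \<ge> 0"
  proof (cases "g \<le> 5/2")
    case True
    then show ?thesis using R gamma_min_bounds(1) gap6_pos[of g] by force
  next
    case False
    then show ?thesis using R gap6_decreasing[of g b] b(3) by (cases "g = b") force+
  qed
  ultimately show "gap6 g \<ge> 0 \<and> gap8 g \<ge> 0" by simp
qed

section \<open>The limit of high frequencies\<close>

text \<open>In terms of \<open>t = 1 / z\<close>, which tends to zero, the quotient is continuous at \<open>t = 0\<close>.\<close>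
lemma suci4_num_limit:
  assumes "c > 0" "\<zeta> \<noteq> 0"
  shows "((\<lambda>\<omega>. suci4_num c (of_real \<omega> * \<zeta>) / (1 - of_real c * (of_real \<omega> * \<zeta>)) ^ 4)
     \<longlongrightarrow> of_real (R_infinity (2 * c))) at_top"
proof -
  define p2 p3 p4 where "p2 = 1/2 - 4 * c + 6 * c\<^sup>2" and "p3 = 1/6 - 2 * c + 6 * c\<^sup>2 - 4 * c ^ 3"
    and "p4 = 1/24 - 2/3 * c + 3 * c\<^sup>2 - 4 * c ^ 3 + c ^ 4"
  define t where "t = (\<lambda>\<omega>. of_real (inverse \<omega>) * inverse \<zeta>)"
  let ?f = "\<lambda>t::complex. (t ^ 4 + of_real (1 - 4 * c) * t ^ 3 + of_real p2 * t\<^sup>2 + of_real p3 * t + of_real p4) / (t - of_real c) ^ 4"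
  have "((\<lambda>\<omega>. of_real (inverse \<omega>) * inverse \<zeta>) \<longlongrightarrow> of_real 0 * inverse \<zeta>) at_top"
    by (intro tendsto_intros tendsto_inverse_0_at_top filterlim_ident)
  then have t: "(t \<longlongrightarrow> 0) at_top" by (simp add: t_def)
  have "((\<lambda>\<omega>. ?f (t \<omega>)) \<longlongrightarrow> ?f 0) at_top"
    using assms(1) by (intro tendsto_intros t) simp
  also have "?f 0 = complex_of_real (p4 / c ^ 4)" by simp
  also have "p4 / c ^ 4 = R_infinity (2 * c)"
    using assms(1) by (simp add: p4_def R_infinity_def field_simps)
  finally have lim: "((\<lambda>\<omega>. ?f (t \<omega>)) \<longlongrightarrow> of_real (R_infinity (2 * c))) at_top" .
  have ev: "eventually (\<lambda>\<omega>. ?f (t \<omega>) = suci4_num c (of_real \<omega> * \<zeta>) / (1 - of_real c * (of_real \<omega> * \<zeta>)) ^ 4) at_top"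
    using eventually_gt_at_top[of 0]
  proof eventually_elim
    case (elim \<omega>)
    define z where "z = of_real \<omega> * \<zeta>"
    have z: "z \<noteq> 0" using elim assms(2) by (simp add: z_def)
    have tz: "t \<omega> = 1 / z" by (simp add: t_def z_def field_simps)
    have "1 / z - of_real c = (1 - of_real c * z) / z" using z by (simp add: field_simps)
    then have den: "(1 / z - of_real c) ^ 4 = (1 - of_real c * z) ^ 4 / z ^ 4" by (simp add: power_divide)
    have "suci4_num c z = 1 + of_real (1 - 4 * c) * z + of_real p2 * z\<^sup>2 + of_real p3 * z ^ 3 + of_real p4 * z ^ 4"
      by (simp only: suci4_num_def p2_def p3_def p4_def)
    then have num: "(1 / z) ^ 4 + of_real (1 - 4 * c) * (1 / z) ^ 3 + of_real p2 * (1 / z)\<^sup>2 + of_real p3 * (1 / z) + of_real p4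
      = suci4_num c z / z ^ 4" using z by (simp add: field_simps power_numeral_reduce)
    show ?case unfolding tz den num z_def[symmetric] using z by simp
  qed
  from Lim_transform_eventually[OF lim ev] show ?thesis .
qed

lemma suci4_char_poly_limit:
  assumes sp: "suci4_params \<alpha> \<gamma>" and dt: "dt > 0" and xi: "\<xi> \<in> {0..<1}"
  shows "((\<lambda>\<omega>. coeff (char_poly (D_num 4 \<alpha> \<gamma> \<xi> \<omega> dt)) k)
             \<longlongrightarrow> coeff ([:- R_infinity (\<gamma> 1), 1:]\<^sup>2) k) at_top"
proof -
  define c where "c = \<gamma> 1 / 2"
  define \<zeta> where "\<zeta> = of_real dt * eig \<xi> 1"
  define r where "r = (\<lambda>\<omega>. suci4_num c (of_real \<omega> * \<zeta>) / (1 - of_real c * (of_real \<omega> * \<zeta>)) ^ 4)"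
  have "c > 0" using sp by (simp add: c_def suci4_params_def)
  moreover have "\<zeta> \<noteq> 0" using eig_props(1)[of 1 \<xi>] xi dt by (auto simp: \<zeta>_def)
  ultimately have r: "(r \<longlongrightarrow> of_real (R_infinity (\<gamma> 1))) at_top"
    using suci4_num_limit[of c \<zeta>] by (simp add: r_def[abs_def] c_def)
  have ev: "eventually (\<lambda>\<omega>. coeff [:(norm (r \<omega>))\<^sup>2, - 2 * Re (r \<omega>), 1:] k = coeff (char_poly (D_num 4 \<alpha> \<gamma> \<xi> \<omega> dt)) k) at_top"
    using eventually_gt_at_top[of 0]
  proof eventually_elim
    case (elim \<omega>)
    have z: "of_real dt * eig \<xi> \<omega> = of_real \<omega> * \<zeta>" by (simp add: \<zeta>_def eig_def complex_eq_iff)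
    have im: "Im (eig \<xi> \<omega>) \<noteq> 0" using eig_props(1)[OF elim xi] by simp
    show ?case unfolding suci4_D_num[OF sp elim xi] char_poly_modal_mat[OF im] z by (simp add: r_def c_def)
  qed
  have "((\<lambda>\<omega>. coeff [:(norm (r \<omega>))\<^sup>2, - 2 * Re (r \<omega>), 1:] k) \<longlongrightarrow>
     coeff [:(norm (complex_of_real (R_infinity (\<gamma> 1))))\<^sup>2, - 2 * Re (of_real (R_infinity (\<gamma> 1))), 1:] k) at_top"
  proof (cases k)
    case 0
    show ?thesis unfolding 0 coeff_pCons_0 by (intro tendsto_intros r)
  next
    case k: (Suc j)
    show ?thesis
    proof (cases j)
      case 0
      show ?thesis unfolding k 0 coeff_pCons_Suc coeff_pCons_0 by (intro tendsto_intros r)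
    qed (simp add: k)
  qed
  also have "[:(norm (complex_of_real (R_infinity (\<gamma> 1))))\<^sup>2, - 2 * Re (of_real (R_infinity (\<gamma> 1))), 1:] = [:- R_infinity (\<gamma> 1), 1:]\<^sup>2"
    by (simp add: power2_eq_square)
  finally show ?thesis by (rule Lim_transform_eventually[OF _ ev])
qed

lemma R_infinity_neg:
  assumes "3/2 \<le> g" "g \<le> 3" shows "R_infinity g < 0"
proof -
  have g: "2 * g - 3 \<ge> 0" "3 - g \<ge> 0" using assms by simp_all
  define p where "p = 3 * g ^ 4 - 24 * g ^ 3 + 36 * g\<^sup>2 - 16 * g + 2"
  have "p < 0"
  proof -
    have "27 * p = - 27 - (31 * (3 - g) ^ 4
        + 180 * (2 * g - 3) * (3 - g) ^ 3
        + 318 * (2 * g - 3) ^ 2 * (3 - g) ^ 2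
        + 212 * (2 * g - 3) ^ 3 * (3 - g)
        + 42 * (2 * g - 3) ^ 4)"
      by (simp add: p_def power_numeral_reduce algebra_simps)
    moreover have "31 * (3 - g) ^ 4
        + 180 * (2 * g - 3) * (3 - g) ^ 3
        + 318 * (2 * g - 3) ^ 2 * (3 - g) ^ 2
        + 212 * (2 * g - 3) ^ 3 * (3 - g)
        + 42 * (2 * g - 3) ^ 4 \<ge> 0"
      using g by (intro add_nonneg_nonneg mult_nonneg_nonneg zero_le_power) auto
    ultimately show ?thesis by linarith
  qed
  then show ?thesis unfolding R_infinity_def p_def using assms by (intro divide_neg_pos) simp_all
qed

text \<open>The sign of the derivative is that of \<open>3 g (g - 1) (g - 2) - 1\<close>.\<close>
lemma R_infinity_decreasing:
  assumes "3/4 \<le> x" "x < y" "y \<le> 2" shows "R_infinity y < R_infinity x"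
proof (rule DERIV_neg_imp_decreasing[OF assms(2)])
  fix g assume g: "x \<le> g" "g \<le> y"
  then have g0: "g > 0" "3/4 \<le> g" "g \<le> 2" using assms by auto
  have neg: "3 * g ^ 3 - 9 * g\<^sup>2 + 6 * g - 1 < 0"
  proof (cases "g \<le> 1")
    case True
    have "g * (1 - g) * (2 - g) \<le> 1/4 * (5/4)"
    proof (rule mult_mono)
      have "g * (1 - g) = 1/4 - (g - 1/2)\<^sup>2" by (simp add: power2_eq_square algebra_simps)
      then show "g * (1 - g) \<le> 1/4" by simp
    qed (use g0 True in auto)
    moreover have "3 * g ^ 3 - 9 * g\<^sup>2 + 6 * g - 1 = 3 * (g * (1 - g) * (2 - g)) - 1"
      by (simp add: power2_eq_square power3_eq_cube algebra_simps)
    ultimately show ?thesis by simp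
  next
    case False
    then have "g * ((g - 1) * (2 - g)) \<ge> 0" using g0 by simp
    moreover have "3 * g ^ 3 - 9 * g\<^sup>2 + 6 * g - 1 = - 3 * (g * ((g - 1) * (2 - g))) - 1"
      by (simp add: power2_eq_square power3_eq_cube algebra_simps)
    ultimately show ?thesis by linarith
  qed
  have "(R_infinity has_real_derivative 8 * (3 * g ^ 3 - 9 * g\<^sup>2 + 6 * g - 1) / (3 * g ^ 5)) (at g)"
    unfolding R_infinity_def[abs_def] using g0
    by (auto intro!: derivative_eq_intros simp: field_simps power_numeral_reduce)
  moreover have "8 * (3 * g ^ 3 - 9 * g\<^sup>2 + 6 * g - 1) / (3 * g ^ 5) < 0"
    using neg g0 by (intro divide_neg_pos) auto
  ultimately show "\<exists>D. (R_infinity has_real_derivative D) (at g) \<and> D < 0" by blast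
qed

lemma R_infinity_gamma_min: "R_infinity gamma_min = 1"
proof -
  have "3 * gamma_min ^ 4 - 24 * gamma_min ^ 3 + 36 * gamma_min\<^sup>2 - 16 * gamma_min + 2 = 3 * gamma_min ^ 4 - 2 * ((2 * gamma_min - 1) * (6 * gamma_min\<^sup>2 - 6 * gamma_min + 1))"
    by (simp add: power_numeral_reduce algebra_simps)
  then show ?thesis unfolding R_infinity_def gamma_min_root using gamma_min_bounds(1) by simp
qed

lemma R_infinity_ex1:
  assumes b: "256115952/10^8 \<le> b" "b \<le> 256115953/10^8" and \<rho>: "\<rho> \<in> {0..1}"
  shows "\<exists>!g. g \<in> {gamma_min..b} \<and> R_infinity g = \<rho>"
proof -
  have "\<exists>g\<ge>gamma_min. g \<le> b \<and> R_infinity g = \<rho>"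
  proof (rule IVT2')
    show "R_infinity b \<le> \<rho>" using R_infinity_neg[of b] b \<rho> by auto
    show "\<rho> \<le> R_infinity gamma_min" using \<rho> R_infinity_gamma_min by simp
    show "gamma_min \<le> b" using gamma_min_bounds(2) b(1) by simp
    show "continuous_on {gamma_min..b} R_infinity" unfolding R_infinity_def[abs_def]
      using gamma_min_bounds(1) by (intro continuous_intros) auto
  qed
  moreover have "x = y" if "x \<in> {gamma_min..b}" "y \<in> {gamma_min..b}" "R_infinity x = \<rho>" "R_infinity y = \<rho>" for x y
  proof -
    have up: "g < 3/2" if "g \<in> {gamma_min..b}" "R_infinity g = \<rho>" for g
      using R_infinity_neg[of g] that b(2) \<rho> by force
    show ?thesis
      using up[OF that(1,3)] up[OF that(2,4)] R_infinity_decreasing[of x y] R_infinity_decreasing[of y x]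
        that gamma_min_bounds(1) by (cases x y rule: linorder_cases) auto
  qed
  ultimately show ?thesis by (auto simp: Ex1_def)
qed

section \<open>The theorem\<close>

theorem mainTheorem3:
  shows "\<exists>a b :: real. a < b \<and>
    \<bar>a - 0.7886751346\<bar> \<le> 1 / 10 ^ 8 \<and> \<bar>b - 2.561159523\<bar> \<le> 1 / 10 ^ 8 \<and>
    (\<forall>(\<alpha> :: nat \<Rightarrow> nat \<Rightarrow> real) (\<gamma> :: nat \<Rightarrow> real). suci4_params \<alpha> \<gamma> \<longrightarrow>
       accurate_of_order 4 4 \<alpha> \<gamma> \<and>
       (unconditionally_stable 4 \<alpha> \<gamma> \<longleftrightarrow> \<gamma> 1 \<in> {a..b}) \<and>
       (\<forall>dt>0. \<forall>\<xi>\<in>{0..<1}. \<forall>k.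
          ((\<lambda>\<omega>. coeff (char_poly (D_num 4 \<alpha> \<gamma> \<xi> \<omega> dt)) k)
             \<longlongrightarrow> coeff ([:- R_infinity (\<gamma> 1), 1:]\<^sup>2) k) at_top)) \<and>
    (\<forall>\<rho>\<in>{0..1}. \<exists>!g. g \<in> {a..b} \<and> R_infinity g = \<rho>)"
proof -
  obtain b where b: "256115952/10^8 \<le> b" "b \<le> 256115953/10^8" "gap6 b = 0"
    using gap6_root by blast
  show ?thesis
  proof (rule exI[of _ gamma_min], rule exI[of _ b], intro conjI allI impI ballI)
    show "gamma_min < b" using gamma_min_bounds(2) b(1) by simp
    show "\<bar>gamma_min - 0.7886751346\<bar> \<le> 1 / 10 ^ 8" unfolding abs_le_iff using gamma_min_bounds by simp
    show "\<bar>b - 2.561159523\<bar> \<le> 1 / 10 ^ 8" unfolding abs_le_iff using b by simp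
    fix \<alpha> :: "nat \<Rightarrow> nat \<Rightarrow> real" and \<gamma> :: "nat \<Rightarrow> real"
    assume sp: "suci4_params \<alpha> \<gamma>"
    show "accurate_of_order 4 4 \<alpha> \<gamma>" by (rule suci4_accurate[OF sp])
    have "\<gamma> 1 > 0" using sp by (simp add: suci4_params_def)
    from stability_interval[OF b this]
    show "unconditionally_stable 4 \<alpha> \<gamma> \<longleftrightarrow> \<gamma> 1 \<in> {gamma_min..b}" by (simp add: suci4_stable_iff[OF sp])
  qed (use suci4_char_poly_limit R_infinity_ex1[OF b(1,2)] in auto)
qed

end
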